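(* Let $X$ and $Y$ be independent real-valued log-concave random variables. Let $Z$ and $W$ be independent exponential random variables such that $h_\infty(Z)=h_\infty(X)$ and $h_\infty(W)=h_\infty(Y)$. Then $$h_\infty(X+Y)\leq h_\infty(Z+W).$$ Consequently, for i.i.d. real-valued log-concave random variables $X$ and $Y$, $$h_\infty(X+Y)\leq h_\infty(X)+1.$$
   Context: A function $f:\mathbb{R}\to[0,\infty)$ is log-concave if $f=e^{-V}$ with $V:\mathbb{R}\to\mathbb{R}\cup\{\infty\}$ convex. A real-valued random variable is log-concave if it has a density with respect to Lebesgue measure that is log-concave. For a real-valued random variable $X$ with density $f$, $h_\infty(X)=-\log\|f\|_\infty$, where $\|f\|_\infty$ is the essential supremum of $f$ and $\log$ is the natural logarithm. An exponential random variable is one with density $\lambda e^{-\lambda x}\mathbf{1}_{[0,\infty)}(x)$ for some $\lambda>0$. *)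

theory Defs
  imports "HOL-Probability.Probability" "HOL-Probability.Essential_Supremum"
begin

definition convex_ext :: "(real \<Rightarrow> ereal) \<Rightarrow> bool" where
  "convex_ext V \<longleftrightarrow>
     (\<forall>x. V x \<noteq> -\<infinity>) \<and>
     (\<forall>x y t. 0 \<le> t \<and> t \<le> 1 \<longrightarrow>
        V ((1 - t) * x + t * y) \<le> ereal (1 - t) * V x + ereal t * V y)"

definition exp_minus_ext :: "ereal \<Rightarrow> real" where
  "exp_minus_ext v = (if v = \<infinity> then 0 else exp (- real_of_ereal v))"

definition log_concave_fun :: "(real \<Rightarrow> real) \<Rightarrow> bool" where
  "log_concave_fun f \<longleftrightarrow> (\<exists>V. convex_ext V \<and> (\<forall>x. f x = exp_minus_ext (V x)))"

definition log_concave_rv :: "'a measure \<Rightarrow> ('a \<Rightarrow> real) \<Rightarrow> bool" where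
  "log_concave_rv M X \<longleftrightarrow>
     (\<exists>f. log_concave_fun f \<and> distributed M lborel X (\<lambda>x. ennreal (f x)))"

definition exponential_rv :: "'a measure \<Rightarrow> ('a \<Rightarrow> real) \<Rightarrow> bool" where
  "exponential_rv M X \<longleftrightarrow>
     (\<exists>l>0. distributed M lborel X (\<lambda>x. ennreal (exponential_density l x)))"

definition ln_ext :: "ennreal \<Rightarrow> ereal" where
  "ln_ext s = (if s = 0 then -\<infinity> else if s = \<infinity> then \<infinity> else ereal (ln (enn2real s)))"

text \<open>The density of \<open>X\<close> is taken to be the Radon--Nikodym derivative of its law.  By
  \<open>h_inf_distributed\<close> below, any other version of the density gives the same value.  If the law
  of \<open>X\<close> has no density, \<open>h_inf M X\<close> is the junk value \<open>\<infinity>\<close>, so an upper bound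
  \<open>h_inf M X \<le> c\<close> with \<open>c\<close> finite never holds for want of a density.\<close>

definition h_inf :: "'a measure \<Rightarrow> ('a \<Rightarrow> real) \<Rightarrow> ereal" where
  "h_inf M X = - ln_ext (esssup lborel (RN_deriv lborel (distr M lborel X)))"

lemma h_inf_distributed:
  assumes "distributed M lborel X f"
  shows "h_inf M X = - ln_ext (esssup lborel f)"
proof -
  have f: "f \<in> borel_measurable lborel" and d: "density lborel f = distr M lborel X"
    using assms by (auto simp: distributed_def)
  have "AE x in lborel. f x = RN_deriv lborel (distr M lborel X) x"
    by (rule sigma_finite_measure.RN_deriv_unique[OF sigma_finite_lborel f d])
  then have "esssup lborel f = esssup lborel (RN_deriv lborel (distr M lborel X))"
    using f by (intro esssup_AE_cong) auto
  then show ?thesis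
    by (simp add: h_inf_def)
qed

end

theory Submission
  imports Defs "HOL-Real_Asymp.Real_Asymp"
begin

text \<open>
  Let \<open>f\<close>, \<open>g\<close> be the densities and \<open>a \<le> b\<close> their essential suprema. The superlevel sets of \<open>f\<close> and
  \<open>g\<close> are intervals whose lengths are concave functions of the logarithm of the level.
  Translate so that a superlevel interval of \<open>f\<close> of length \<open>L\<close> coincides with the reflection of one
  of \<open>g\<close>. By nestedness, a superlevel interval of \<open>f\<close> of length \<open>\<alpha>\<close> and a reflected one of \<open>g\<close> of
  length \<open>\<beta>\<close> then overlap in length at least \<open>min \<alpha> L + min \<beta> L - L\<close>, and integrating over all pairs
  of levels bounds the convolution from below at one point. For \<open>L\<close> the mode of the sum of two
  exponentials, Jensen's inequality for the lengths of \<open>f\<close> and a single-crossing argument for those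
  of \<open>g\<close> bound the double integral by the value it has for exponential densities, which is the
  peak of their convolution.
\<close>

section \<open>Integrals of functions of the logarithmic level\<close>

text \<open>Up to a constant factor, \<open>A - ln t\<close> is the length of the superlevel set of
  an exponential density at level \<open>t\<close>. The antiderivative
  \<open>t * (A - ln t) + t\<close> extends continuously to 0 with value 0, which is the only
  delicate point.\<close>

lemma has_integral_log_level:
  fixes A :: real
  shows "((\<lambda>t. A - ln t) has_integral exp A) {0<..<exp A}"
proof -
  have lim: "((\<lambda>t::real. t * (A - ln t) + t) \<longlongrightarrow> 0) (at_right 0)"
    by real_asymp
  have "continuous_on {0..exp A} (\<lambda>t. t * (A - ln t) + t)"
    unfolding continuous_on_def
  proof
    fix x assume x: "x \<in> {0..exp A}"
    show "((\<lambda>t. t * (A - ln t) + t) \<longlongrightarrow> x * (A - ln x) + x) (at x within {0..exp A})"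
    proof (cases "x = 0")
      case True
      then show ?thesis
        using lim by (simp add: at_within_Icc_at_right)
    next
      case False
      then show ?thesis
        using x by (auto intro!: tendsto_eq_intros)
    qed
  qed
  moreover have "((\<lambda>t. t * (A - ln t) + t) has_vector_derivative (A - ln t)) (at t)"
    if "t \<in> {0<..<exp A}" for t
    unfolding has_real_derivative_iff_has_vector_derivative[symmetric]
    using that by (auto intro!: derivative_eq_intros)
  ultimately have "((\<lambda>t. A - ln t) has_integral
      (exp A * (A - ln (exp A)) + exp A - (0 * (A - ln 0) + 0))) {0..exp A}"
    by (intro fundamental_theorem_of_calculus_interior) auto
  then show ?thesis
    by (simp add: has_integral_Icc_iff_Ioo)
qed

text \<open>The mode of the sum of two independent exponential variables with rates \<open>a\<close> and \<open>b\<close>.\<close>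

definition optimal_shift :: "real \<Rightarrow> real \<Rightarrow> real" where
  "optimal_shift a b = (if a = b then 1 / a else (ln b - ln a) / (b - a))"

text \<open>The exponential identity is the first-order condition
  \<open>a * exp (- a * L) = b * exp (- b * L)\<close> at the mode \<open>L\<close>. The bound by
  \<open>1 / a\<close> later lets a profile estimate valid up to height \<open>1 / a\<close> survive
  truncation at \<open>L\<close>.\<close>

lemma optimal_shift:
  assumes "0 < a" "a \<le> b"
  shows "0 < optimal_shift a b" "optimal_shift a b \<le> 1 / a"
    "exp ((b - a) * optimal_shift a b) = b / a"
proof -
  show "0 < optimal_shift a b" "exp ((b - a) * optimal_shift a b) = b / a"
    using assms by (auto simp: optimal_shift_def exp_diff)
  have "ln b - ln a \<le> (b - a) / a"
    using assms ln_le_minus_one[of "b / a"] by (simp add: ln_div diff_divide_distrib)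
  then show "optimal_shift a b \<le> 1 / a"
    using assms by (auto simp: optimal_shift_def field_simps)
qed

text \<open>The value equals the integral of \<open>a * (B - ln t) / b\<close> over the same
  interval, for every \<open>B\<close>. This coincidence is special to the choice of
  \<open>L\<close>; the single-crossing argument rests on it.\<close>

lemma has_integral_truncated_exp_level:
  fixes a b B :: real
  assumes ab: "0 < a" "a \<le> b"
  defines "L \<equiv> optimal_shift a b"
  shows "((\<lambda>t. exp (a * min L ((B - ln t) / b)) - 1) has_integral (a / b * exp B)) {0<..<exp B}"
proof -
  have L: "0 < L" "exp ((b - a) * L) = b / a"
    using optimal_shift[OF ab] by (auto simp: L_def)
  \<comment> \<open>The level at which \<open>(B - ln t) / b\<close> equals \<open>L\<close>: the
    truncation acts below \<open>t1\<close> only.\<close>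
  define t1 where "t1 = exp (B - b * L)"
  have t1: "0 < t1" "t1 \<le> exp B" "ln t1 = B - b * L"
    using ab L by (auto simp: t1_def)
  have e: "exp (a * L) = a / b * exp (b * L)"
  proof -
    have "exp (b * L) = exp ((b - a) * L) * exp (a * L)"
      by (simp add: exp_add[symmetric] algebra_simps)
    then show ?thesis using L ab by simp
  qed
  have t1e: "t1 * exp (a * L) = a / b * exp B"
    by (simp add: e t1_def exp_diff)
  have "((\<lambda>t. exp (a * L) - 1) has_integral t1 * (exp (a * L) - 1)) {0..t1}"
    using has_integral_const_real[of "exp (a * L) - 1" 0 t1] t1 by simp
  then have "((\<lambda>t. exp (a * min L ((B - ln t) / b)) - 1) has_integral t1 * (exp (a * L) - 1)) {0<..<t1}"
    unfolding has_integral_Icc_iff_Ioo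
  proof (rule has_integral_eq[rotated])
    fix t assume t: "t \<in> {0<..<t1}"
    then have "ln t < B - b * L"
      using t1 by (metis greaterThanLessThan_iff ln_less_cancel_iff)
    then have "L \<le> (B - ln t) / b"
      using ab by (simp add: field_simps)
    then show "exp (a * L) - 1 = exp (a * min L ((B - ln t) / b)) - 1" by simp
  qed
  then have I1: "((\<lambda>t. exp (a * min L ((B - ln t) / b)) - 1) has_integral t1 * (exp (a * L) - 1)) {0..t1}"
    by (simp add: has_integral_Icc_iff_Ioo)
  \<comment> \<open>The value is just \<open>t1\<close>. It cancels the \<open>- 1\<close>
    integrated over \<open>{0..t1}\<close>, leaving the total \<open>t1 * exp (a * L)\<close>. The
    antiderivative is logarithmic when \<open>a = b\<close> and a power of \<open>t\<close>
    otherwise.\<close>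
  have I2': "((\<lambda>t. exp (a * ((B - ln t) / b)) - 1) has_integral exp B - (exp B - t1)) {t1..exp B}"
  proof (cases "a = b")
    case True
    have bL: "b * L = 1" using True ab by (simp add: L_def optimal_shift_def)
    have "((\<lambda>t. exp (a * ((B - ln t) / b)) - 1) has_integral
        (exp B * ln (exp B) - exp B - (exp B * ln t1 - t1))) {t1..exp B}"
    proof (rule fundamental_theorem_of_calculus)
      fix t assume "t \<in> {t1..exp B}"
      then have "0 < t" using t1 by auto
      then have "((\<lambda>t. exp B * ln t - t) has_real_derivative exp (a * ((B - ln t) / b)) - 1) (at t)"
        using ab True by (auto intro!: derivative_eq_intros simp: exp_diff)
      then show "((\<lambda>t. exp B * ln t - t) has_vector_derivative exp (a * ((B - ln t) / b)) - 1)
          (at t within {t1..exp B})"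
        by (simp add: has_real_derivative_iff_has_vector_derivative has_vector_derivative_at_within)
    qed (use t1 in auto)
    moreover have "ln t1 = B - 1" using t1 bL by simp
    ultimately show ?thesis by (simp add: right_diff_distrib)
  next
    case False
    define c where "c = a / b"
    have c: "0 < c" "c < 1" using ab False by (auto simp: c_def)
    define k where "k = 1 / (1 - c)"
    have k: "(1 - c) * k = 1" using c by (simp add: k_def)
    define F where "F = (\<lambda>t. t * exp (c * (B - ln t)) * k - t)"
    have "((\<lambda>t. exp (a * ((B - ln t) / b)) - 1) has_integral (F (exp B) - F t1)) {t1..exp B}"
    proof (rule fundamental_theorem_of_calculus)
      fix t assume "t \<in> {t1..exp B}"
      then have "0 < t" using t1 by auto
      have "(F has_real_derivative
          (exp (c * (B - ln t)) + t * (exp (c * (B - ln t)) * (- c / t))) * k - 1) (at t)"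
        unfolding F_def using \<open>0 < t\<close> by (auto intro!: derivative_eq_intros)
      also have "(exp (c * (B - ln t)) + t * (exp (c * (B - ln t)) * (- c / t))) * k - 1
          = exp (c * (B - ln t)) * ((1 - c) * k) - 1"
        using \<open>0 < t\<close> by (simp add: algebra_simps)
      also have "\<dots> = exp (a * ((B - ln t) / b)) - 1"
        by (simp add: c_def k[unfolded c_def])
      finally show "(F has_vector_derivative exp (a * ((B - ln t) / b)) - 1) (at t within {t1..exp B})"
        by (simp add: has_real_derivative_iff_has_vector_derivative has_vector_derivative_at_within)
    qed (use t1 in auto)
    moreover have "F (exp B) - F t1 = exp B - (exp B - t1)"
    proof -
      have "c * (b * L) = a * L" using ab by (simp add: c_def)
      then have "F t1 = c * exp B * k - t1"
        using t1 t1e by (simp add: F_def c_def)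
      moreover have "F (exp B) = exp B * k - exp B" by (simp add: F_def)
      moreover have "exp B * k - c * exp B * k = exp B * ((1 - c) * k)"
        by (simp add: algebra_simps)
      ultimately show ?thesis by (simp add: k)
    qed
    ultimately show ?thesis by simp
  qed
  have I2: "((\<lambda>t. exp (a * min L ((B - ln t) / b)) - 1) has_integral exp B - (exp B - t1)) {t1..exp B}"
  proof (rule has_integral_eq[rotated, OF I2'])
    fix t assume t: "t \<in> {t1..exp B}"
    then have "B - b * L \<le> ln t"
      using t1 by (metis atLeastAtMost_iff ln_mono)
    then have "(B - ln t) / b \<le> L"
      using ab by (simp add: field_simps)
    then show "exp (a * ((B - ln t) / b)) - 1 = exp (a * min L ((B - ln t) / b)) - 1" by simp
  qed
  have "((\<lambda>t. exp (a * min L ((B - ln t) / b)) - 1) has_integral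
      t1 * (exp (a * L) - 1) + (exp B - (exp B - t1))) {0..exp B}"
    using t1 by (intro has_integral_combine[OF _ _ I1 I2]) auto
  then show ?thesis
    using t1e by (simp add: has_integral_Icc_iff_Ioo algebra_simps)
qed

text \<open>The inner integral of the overlap bound when the levels \<open>s\<close> belong to the
  exponential density of rate \<open>a\<close> and \<open>y\<close> is the truncated length from the
  other density.\<close>

lemma has_integral_truncated_log_level:
  fixes a L y :: real
  assumes a: "0 < a" and y: "0 \<le> y" "y \<le> L"
  shows "((\<lambda>s. max 0 (min L ((ln a - ln s) / a) + y - L)) has_integral
    exp (- a * L) * (exp (a * y) - 1)) {0<..<a}"
proof -
  let ?h = "\<lambda>s. max 0 (min L ((ln a - ln s) / a) + y - L)"
  \<comment> \<open>The levels at which the exponential length equals \<open>L\<close> and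
    \<open>L - y\<close>. The integrand is constant \<open>y\<close> below \<open>s1\<close>, affine
    in \<open>ln s\<close> between them, and zero above \<open>s2\<close>.\<close>
  define s1 s2 where "s1 = a * exp (- a * L)" and "s2 = a * exp (- a * (L - y))"
  have s: "0 < s1" "s1 \<le> s2" "s2 \<le> a" "ln s1 = ln a - a * L" "ln s2 = ln a - a * (L - y)"
    using a y by (auto simp: s1_def s2_def ln_mult)
  have "((\<lambda>t. y) has_integral s1 * y) {0..s1}"
    using has_integral_const_real[of y 0 s1] s by simp
  then have "(?h has_integral s1 * y) {0<..<s1}"
    unfolding has_integral_Icc_iff_Ioo
  proof (rule has_integral_eq[rotated])
    fix t assume t: "t \<in> {0<..<s1}"
    then have "ln t < ln a - a * L"
      using s by (metis greaterThanLessThan_iff ln_less_cancel_iff)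
    then have "L \<le> (ln a - ln t) / a"
      using a by (simp add: field_simps)
    then show "y = ?h t" using y by simp
  qed
  then have I1: "(?h has_integral s1 * y) {0..s1}"
    by (simp add: has_integral_Icc_iff_Ioo)
  have "((\<lambda>s. (ln a - ln s) / a + y - L) has_integral
      (s2 * ((ln a - ln s2) / a + y - L) + s2 / a - (s1 * ((ln a - ln s1) / a + y - L) + s1 / a))) {s1..s2}"
  proof (rule fundamental_theorem_of_calculus)
    fix t assume "t \<in> {s1..s2}"
    then have "0 < t" using s by auto
    then have "((\<lambda>s. s * ((ln a - ln s) / a + y - L) + s / a) has_real_derivative
        (ln a - ln t) / a + y - L) (at t)"
      using a by (auto intro!: derivative_eq_intros simp: field_simps)
    then show "((\<lambda>s. s * ((ln a - ln s) / a + y - L) + s / a) has_vector_derivative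
        (ln a - ln t) / a + y - L) (at t within {s1..s2})"
      by (simp add: has_real_derivative_iff_has_vector_derivative has_vector_derivative_at_within)
  qed (use s in auto)
  then have "((\<lambda>s. (ln a - ln s) / a + y - L) has_integral ((s2 - s1) / a - s1 * y)) {s1..s2}"
    using a s by (simp add: diff_divide_distrib algebra_simps)
  then have I2: "(?h has_integral ((s2 - s1) / a - s1 * y)) {s1..s2}"
  proof (rule has_integral_eq[rotated])
    fix t assume t: "t \<in> {s1..s2}"
    then have "ln a - a * L \<le> ln t" "ln t \<le> ln a - a * (L - y)"
      using s by (metis atLeastAtMost_iff ln_mono, metis atLeastAtMost_iff ln_mono order_less_le_trans)
    then have "(ln a - ln t) / a \<le> L" "(ln a - ln t) / a \<ge> L - y"
      using a by (auto simp: field_simps)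
    then show "(ln a - ln t) / a + y - L = ?h t" by simp
  qed
  have I3: "(?h has_integral 0) {s2..a}"
  proof (rule has_integral_is_0)
    fix t assume t: "t \<in> {s2..a}"
    then have "ln a - a * (L - y) \<le> ln t"
      using s by (metis atLeastAtMost_iff ln_mono order_less_le_trans)
    then have "(ln a - ln t) / a \<le> L - y"
      using a by (auto simp: field_simps)
    then show "?h t = 0" by simp
  qed
  have "(?h has_integral s1 * y + ((s2 - s1) / a - s1 * y)) {0..s2}"
    using s by (intro has_integral_combine[OF _ _ I1 I2]) auto
  then have "(?h has_integral s1 * y + ((s2 - s1) / a - s1 * y) + 0) {0..a}"
    using s by (intro has_integral_combine[OF _ _ _ I3]) auto
  moreover have "(s2 - s1) / a = exp (- a * L) * (exp (a * y) - 1)"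
    using a by (simp add: s1_def s2_def right_diff_distrib exp_diff exp_minus field_simps)
  ultimately show ?thesis
    by (simp add: has_integral_Icc_iff_Ioo)
qed

section \<open>Concave profiles\<close>

text \<open>Equivalently, \<open>\<phi> u / (A - u)\<close> is nondecreasing: the graph at
  \<open>v\<close> lies above the chord from the point at \<open>u\<close> to \<open>(A, 0)\<close>.
  As \<open>A\<close> is outside the domain, the chord ends at \<open>w < A\<close>, where
  \<open>\<phi> w\<close> is nonnegative, and \<open>w\<close> tends to \<open>A\<close>.\<close>

lemma concave_chord_to_endpoint:
  fixes \<phi> :: "real \<Rightarrow> real"
  assumes conc: "concave_on {..<A} \<phi>" and nonneg: "\<And>u. u < A \<Longrightarrow> 0 \<le> \<phi> u"
    and "u \<le> v" "v < A"
  shows "\<phi> u * (A - v) \<le> \<phi> v * (A - u)"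
proof (cases "u = v")
  case False
  then have "u < v" using assms by simp
  have *: "\<phi> u * (w - v) \<le> \<phi> v * (w - u)" if "v < w" "w < A" for w
  proof -
    define t where "t = (v - u) / (w - u)"
    have t: "0 \<le> t" "t \<le> 1" "1 - t = (w - v) / (w - u)"
      using \<open>u < v\<close> that by (auto simp: t_def field_simps)
    have "(1 - t) * u + t * w = u + t * (w - u)"
      by (simp add: algebra_simps)
    also have "\<dots> = v" using \<open>u < v\<close> that by (simp add: t_def)
    finally have "(1 - t) * \<phi> u + t * \<phi> w \<le> \<phi> v"
      using concave_onD[OF conc t(1,2), of u w] \<open>u < v\<close> that by simp
    moreover have "0 \<le> t * \<phi> w" using t nonneg that by simp
    ultimately have "(w - v) / (w - u) * \<phi> u \<le> \<phi> v" using t by simp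
    then show ?thesis using \<open>u < v\<close> that by (simp add: field_simps)
  qed
  show ?thesis
  proof (rule tendsto_le[of "at_left A"])
    show "((\<lambda>w. \<phi> u * (w - v)) \<longlongrightarrow> \<phi> u * (A - v)) (at_left A)"
      by (intro tendsto_intros)
    show "((\<lambda>w. \<phi> v * (w - u)) \<longlongrightarrow> \<phi> v * (A - u)) (at_left A)"
      by (intro tendsto_intros)
    show "\<forall>\<^sub>F w in at_left A. \<phi> u * (w - v) \<le> \<phi> v * (w - u)"
      using eventually_at_left_real[OF \<open>v < A\<close>] by eventually_elim (auto intro: *)
  qed simp
qed simp

text \<open>Jensen's inequality: for \<open>s\<close> uniform on \<open>{0<..<exp A}\<close> the
  mean of \<open>ln s\<close> is \<open>A - 1\<close>. Concretely, the supporting line of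
  \<open>\<phi>\<close> at \<open>A - 1\<close> is integrated.\<close>

lemma profile_at_unit_depth:
  fixes \<phi> :: "real \<Rightarrow> real"
  assumes conc: "concave_on {..<A} \<phi>"
    and int: "((\<lambda>s. \<phi> (ln s)) has_integral 1) {0<..<exp A}"
  shows "1 \<le> exp A * \<phi> (A - 1)"
proof -
  have cv: "convex_on {..<A} (\<lambda>x. - \<phi> x)"
    using conc by (simp add: concave_on_def)
  obtain \<sigma> where \<sigma>: "- \<phi> y \<ge> - \<phi> (A - 1) + \<sigma> * (y - (A - 1))" if "y < A" for y
    using convex_le_Inf_differential[OF cv, of "A - 1"] by (auto simp: interior_open)
  have "((\<lambda>s. \<phi> (A - 1) - \<sigma> + \<sigma> * (A - ln s)) has_integral
      exp A * (\<phi> (A - 1) - \<sigma>) + \<sigma> * exp A) {0<..<exp A}"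
    using has_integral_const_real[of "\<phi> (A - 1) - \<sigma>" 0 "exp A"]
    by (intro has_integral_add has_integral_mult_right has_integral_log_level)
      (simp add: has_integral_Icc_iff_Ioo)
  then have "1 \<le> exp A * (\<phi> (A - 1) - \<sigma>) + \<sigma> * exp A"
  proof (rule has_integral_le[OF int])
    fix s assume "s \<in> {0<..<exp A}"
    then have "ln s < A" by (metis greaterThanLessThan_iff ln_exp ln_less_cancel_iff exp_gt_zero)
    from \<sigma>[OF this] show "\<phi> (ln s) \<le> \<phi> (A - 1) - \<sigma> + \<sigma> * (A - ln s)"
      by (simp add: algebra_simps)
  qed
  then show ?thesis by (simp add: algebra_simps)
qed

text \<open>Compares with \<open>(A - u) / exp A\<close>, the profile of the exponential density of
  rate \<open>exp A\<close>, capped at its value at depth 1. Beyond depth 1 monotonicity carries the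
  Jensen bound; nearer the peak the chord to the endpoint does.\<close>

lemma profile_lower_bound:
  fixes \<phi> :: "real \<Rightarrow> real"
  assumes conc: "concave_on {..<A} \<phi>" and nonneg: "\<And>u. u < A \<Longrightarrow> 0 \<le> \<phi> u"
    and anti: "\<And>u v. u \<le> v \<Longrightarrow> v < A \<Longrightarrow> \<phi> v \<le> \<phi> u"
    and int: "((\<lambda>s. \<phi> (ln s)) has_integral 1) {0<..<exp A}"
    and "u < A"
  shows "min (1 / exp A) ((A - u) / exp A) \<le> \<phi> u"
proof -
  have 1: "1 / exp A \<le> \<phi> (A - 1)"
    using profile_at_unit_depth[OF conc int] by (simp add: field_simps)
  show ?thesis
  proof (cases "u \<le> A - 1")
    case True
    then show ?thesis using anti[of u "A - 1"] 1 by simp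
  next
    case False
    have "(A - u) / exp A = 1 / exp A * (A - u)" by simp
    also have "\<dots> \<le> \<phi> (A - 1) * (A - u)"
      using 1 \<open>u < A\<close> by (intro mult_right_mono) auto
    also have "\<dots> \<le> \<phi> u"
      using concave_chord_to_endpoint[OF conc nonneg, of "A - 1" u] False \<open>u < A\<close> by simp
    finally show ?thesis by simp
  qed
qed

text \<open>The gap \<open>exp (a * min L y) - 1 - a * y\<close> increases up to \<open>y = L\<close> and decreases afterwards.
  Concavity lets the line of slope \<open>- 1 / b\<close> through the point where \<open>\<psi>\<close> crosses the level \<open>L\<close>
  be farther from \<open>L\<close> than \<open>\<psi>\<close> everywhere, and for lines the gap integrates to zero.\<close>

lemma profile_truncated_exp_integral:
  fixes \<psi> :: "real \<Rightarrow> real"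
  assumes ab: "0 < a" "a \<le> b" and meas: "\<psi> \<in> borel_measurable borel"
    and conc: "concave_on {..<ln b} \<psi>" and nonneg: "\<And>u. u < ln b \<Longrightarrow> 0 \<le> \<psi> u"
    and anti: "\<And>u v. u \<le> v \<Longrightarrow> v < ln b \<Longrightarrow> \<psi> v \<le> \<psi> u"
    and int: "((\<lambda>s. \<psi> (ln s)) has_integral 1) {0<..<b}"
  defines "L \<equiv> optimal_shift a b"
  shows "\<exists>I\<ge>a. ((\<lambda>t. exp (a * min L (\<psi> (ln t))) - 1) has_integral I) {0<..<b}"
proof -
  define B where "B = ln b"
  have "0 < b" using ab by simp
  have B: "exp B = b" using ab by (simp add: B_def)
  have lnB: "ln t < B" if "t \<in> {0<..<b}" for t
    using that by (simp add: B_def)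
  have L: "0 < L" using optimal_shift[OF ab] by (simp add: L_def)
  note trunc = has_integral_truncated_exp_level[OF ab, folded L_def]
  let ?q = "\<lambda>t. exp (a * min L (\<psi> (ln t))) - 1"
  have qb: "norm (?q t) \<le> exp (a * L)" if "t \<in> {0<..<b}" for t
  proof -
    have "0 \<le> a * min L (\<psi> (ln t))" "a * min L (\<psi> (ln t)) \<le> a * L"
      using ab L nonneg that by (auto intro!: mult_nonneg_nonneg mult_left_mono)
    then have "1 \<le> exp (a * min L (\<psi> (ln t)))" "exp (a * min L (\<psi> (ln t))) \<le> exp (a * L)"
      by simp_all
    then show ?thesis unfolding real_norm_def by linarith
  qed
  have "?q integrable_on {0<..<b}"
  proof (rule measurable_bounded_by_integrable_imp_integrable[OF _ _ qb])
    have "?q \<in> borel_measurable borel"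
      using meas by measurable
    then have "?q \<in> borel_measurable lebesgue"
      by (metis borel_measurable_if_lebesgue_on lborelD measurable_completion measurable_lborel2)
    then show "?q \<in> borel_measurable (lebesgue_on {0<..<b})"
      by (rule measurable_restrict_space1)
    show "(\<lambda>t. exp (a * L)) integrable_on {0<..<b}"
      by (simp add: integrable_on_open_interval_real integrable_const_ivl)
  qed auto
  then obtain I where I: "(?q has_integral I) {0<..<b}" by blast
  have "a \<le> I"
  \<comment> \<open>Three cases. If the truncation never acts, \<open>exp z \<ge> 1 + z\<close>
    suffices. If \<open>\<psi>\<close> dominates the truncated exponential profile, monotonicity
    suffices. Otherwise \<open>\<psi>\<close> exceeds \<open>L\<close> somewhere and falls below
    both \<open>L\<close> and the exponential profile at some \<open>w\<close>, so it crosses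
    \<open>L\<close>.\<close>
  proof (cases "\<forall>u<B. \<psi> u \<le> L")
    case True
    have "((\<lambda>t. a * \<psi> (ln t)) has_integral a * 1) {0<..<b}"
      by (intro has_integral_mult_right int)
    then have "a * 1 \<le> I"
    proof (rule has_integral_le[OF _ I])
      fix t assume "t \<in> {0<..<b}"
      then have "\<psi> (ln t) \<le> L" using True lnB by auto
      then have "min L (\<psi> (ln t)) = \<psi> (ln t)" by simp
      then show "a * \<psi> (ln t) \<le> ?q t"
        using exp_ge_add_one_self[of "a * \<psi> (ln t)"] by (simp only: le_diff_eq add.commute)
    qed
    then show ?thesis by simp
  next
    case notle: False
    show ?thesis
    proof (cases "\<forall>u<B. min L ((B - u) / b) \<le> \<psi> u")
      case True
      have "((\<lambda>t. exp (a * min L ((B - ln t) / b)) - 1) has_integral a) {0<..<b}"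
        using trunc[of B] B \<open>0 < b\<close> by simp
      then show ?thesis
      proof (rule has_integral_le[OF _ I])
        fix t assume "t \<in> {0<..<b}"
        then have "min L ((B - ln t) / b) \<le> min L (\<psi> (ln t))" using True lnB by auto
        then show "exp (a * min L ((B - ln t) / b)) - 1 \<le> ?q t"
          using ab by (simp add: mult_left_mono)
      qed
    next
      case False
      then obtain w where w: "w < B" "\<psi> w < L" "\<psi> w < (B - w) / b" by (auto simp: not_le)
      define S where "S = {u. u < B \<and> L \<le> \<psi> u}"
      have S_ne: "S \<noteq> {}" using notle by (auto simp: S_def not_le intro: less_imp_le)
      have Sw: "u \<le> w" if "u \<in> S" for u
        using anti[of w u] that w unfolding S_def B_def by force
      have bdd: "bdd_above S" using Sw by (auto simp: bdd_above_def)
      define u1 where "u1 = Sup S"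
      have u1w: "u1 \<le> w" using cSup_least[OF S_ne Sw] by (simp add: u1_def)
      have chord: "\<psi> u * (B - v) \<le> \<psi> v * (B - u)" if "u \<le> v" "v < B" for u v
        using concave_chord_to_endpoint[OF conc nonneg] that by (auto simp: B_def)
      have below: "L \<le> \<psi> u" if u: "u < u1" for u
      proof -
        obtain v where "v \<in> S" "u < v"
          using u unfolding u1_def less_cSup_iff[OF S_ne bdd] by blast
        then show ?thesis using anti[of u v] by (auto simp: S_def B_def)
      qed
      have above: "\<psi> u \<le> L" if "u1 < u" "u < B" for u
        using that cSup_upper[OF _ bdd, of u] by (force simp: u1_def S_def)
      \<comment> \<open>The zero of the line of slope \<open>- 1 / b\<close> that has height
        \<open>L\<close> at the crossing point \<open>u1\<close>.\<close>
      define C where "C = u1 + b * L"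
      \<comment> \<open>The ratio \<open>\<psi> u / (B - u)\<close> is at most its value at
        \<open>w\<close>, hence at most \<open>1 / b\<close>, while \<open>\<psi> u\<close> is at
        least \<open>L\<close>. This yields \<open>C \<le> B\<close>: the line reaches zero no later
        than the peak.\<close>
      have "u \<le> B - b * L" if "u \<in> S" for u
      proof -
        have "L * (B - w) \<le> \<psi> u * (B - w)"
          using that w by (intro mult_right_mono) (auto simp: S_def)
        also have "\<dots> \<le> \<psi> w * (B - u)" using chord Sw that w by simp
        also have "\<dots> \<le> (B - w) / b * (B - u)"
          using w that by (intro mult_right_mono) (auto simp: S_def)
        finally have "(B - w) * L \<le> (B - w) * ((B - u) / b)" by (simp add: mult.commute)
        then have "L \<le> (B - u) / b"
          by (rule mult_left_le_imp_le) (use w in simp)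
        then show ?thesis using \<open>0 < b\<close> by (simp add: field_simps)
      qed
      then have CB: "C \<le> B"
        using cSup_least[OF S_ne, of "B - b * L"] by (simp add: C_def u1_def)
      have line: "(C - u) / b = L + (u1 - u) / b" for u
        using \<open>0 < b\<close> by (simp add: C_def field_simps)
      have upper: "\<psi> u \<le> (C - u) / b" if "u \<le> u1" for u
      proof (rule field_le_epsilon)
        fix e :: real assume "0 < e"
        \<comment> \<open>A point just right of the crossing replaces an appeal to continuity at
          \<open>u1\<close>. Capping it at \<open>w\<close> preserves
          \<open>\<psi> v \<le> (B - v) / b\<close>, which bounds the slope of the chord back to
          \<open>u\<close>.\<close>
        define v where "v = min (u1 + b * e) w"
        have v: "u1 \<le> v" "v \<le> w" "v \<le> u1 + b * e"
          using u1w \<open>0 < e\<close> \<open>0 < b\<close> by (auto simp: v_def)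
        have "u1 < v \<or> v = w" using \<open>0 < e\<close> \<open>0 < b\<close> by (auto simp: v_def min_def)
        then have vL: "\<psi> v \<le> L" using above v w by auto
        have "\<psi> v * (B - w) \<le> \<psi> w * (B - v)" using chord v w by simp
        also have "\<dots> \<le> (B - w) / b * (B - v)"
          using w v by (intro mult_right_mono) auto
        finally have "(B - w) * \<psi> v \<le> (B - w) * ((B - v) / b)" by (simp add: mult.commute)
        then have vb: "\<psi> v \<le> (B - v) / b"
          by (rule mult_left_le_imp_le) (use w in simp)
        have "\<psi> u * (B - v) \<le> \<psi> v * (B - u)" using chord v w that by simp
        also have "\<dots> = \<psi> v * (B - v) + \<psi> v * (v - u)" by (simp add: algebra_simps)
        also have "\<dots> \<le> \<psi> v * (B - v) + (B - v) / b * (v - u)"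
          using vb v that by (intro add_left_mono mult_right_mono) auto
        also have "\<dots> = (B - v) * (\<psi> v + (v - u) / b)" by (simp add: algebra_simps)
        finally have "(B - v) * \<psi> u \<le> (B - v) * (\<psi> v + (v - u) / b)" by (simp add: mult.commute)
        then have "\<psi> u \<le> \<psi> v + (v - u) / b"
          by (rule mult_left_le_imp_le) (use w v in simp)
        also have "\<dots> \<le> L + (u1 + b * e - u) / b"
          using vL v \<open>0 < b\<close> by (intro add_mono divide_right_mono) auto
        also have "\<dots> = (C - u) / b + e" unfolding line using \<open>0 < b\<close> by (simp add: field_simps)
        finally show "\<psi> u \<le> (C - u) / b + e" .
      qed
      \<comment> \<open>Where \<open>\<psi>\<close> is above the parallel line ending at
        \<open>B\<close>, this is \<open>C \<le> B\<close>. Elsewhere the chord estimate shows that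
        \<open>\<psi>\<close> drops from a point of \<open>S\<close> close to \<open>u1\<close> with
        slope at most \<open>1 / b\<close>.\<close>
      have lower: "(C - u) / b \<le> \<psi> u" if "u1 \<le> u" "u < B" for u
      proof (cases "(B - u) / b \<le> \<psi> u")
        case True
        have "(C - u) / b \<le> (B - u) / b"
          using CB \<open>0 < b\<close> by (intro divide_right_mono) auto
        with True show ?thesis by simp
      next
        case False
        show ?thesis
        proof (rule field_le_epsilon)
          fix e :: real assume "0 < e"
          have "u1 - b * e < u1" using \<open>0 < e\<close> \<open>0 < b\<close> by simp
          then obtain v where v: "v \<in> S" "u1 - b * e < v"
            using less_cSup_iff[OF S_ne bdd, of "u1 - b * e"] by (auto simp flip: u1_def)
          have vu: "v \<le> u" using cSup_upper[OF v(1) bdd] that by (simp add: u1_def)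
          have "L * (B - u) \<le> \<psi> v * (B - u)"
            using v that by (intro mult_right_mono) (auto simp: S_def)
          also have "\<dots> \<le> \<psi> u * (B - v)" using chord vu that by simp
          also have "\<dots> = \<psi> u * (B - u) + \<psi> u * (u - v)" by (simp add: algebra_simps)
          also have "\<dots> \<le> \<psi> u * (B - u) + (B - u) / b * (u - v)"
            using False vu by (intro add_left_mono mult_right_mono) auto
          also have "\<dots> = (B - u) * (\<psi> u + (u - v) / b)" by (simp add: algebra_simps)
          finally have "(B - u) * L \<le> (B - u) * (\<psi> u + (u - v) / b)" by (simp add: mult.commute)
          then have "L \<le> \<psi> u + (u - v) / b"
          by (rule mult_left_le_imp_le) (use that in simp)
          moreover have "(u - v) / b \<le> (u - (u1 - b * e)) / b"
            using v \<open>0 < b\<close> by (intro divide_right_mono) auto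
          moreover have "(u - (u1 - b * e)) / b = e - (u1 - u) / b"
            using \<open>0 < b\<close> by (simp add: field_simps)
          ultimately show "(C - u) / b \<le> \<psi> u + e" unfolding line by linarith
        qed
      qed
      define k where "k = (\<lambda>y. exp (a * min L y) - 1 - a * y)"
      have k_up: "k x \<le> k y" if "0 \<le> x" "x \<le> y" "y \<le> L" for x y
      proof -
        have "exp (a * y) = exp (a * x) * exp (a * (y - x))"
          by (simp add: exp_add[symmetric] algebra_simps)
        moreover have "exp (a * x) * (exp (a * (y - x)) - 1) \<ge> 1 * (exp (a * (y - x)) - 1)"
          using ab that by (intro mult_right_mono) auto
        moreover have "1 + a * (y - x) \<le> exp (a * (y - x))" by (rule exp_ge_add_one_self)
        ultimately show ?thesis using that by (simp add: k_def algebra_simps)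
      qed
      have k_down: "k y \<le> k x" if "L \<le> x" "x \<le> y" for x y
        using ab that by (simp add: k_def)
      \<comment> \<open>The gap along the comparison line. Clipping at 0 keeps the argument in the
        range where \<open>k\<close> is monotone, and makes \<open>r\<close> vanish beyond
        \<open>exp C\<close> because \<open>k 0 = 0\<close>.\<close>
      define r where "r = (\<lambda>t. k (max 0 ((C - ln t) / b)))"
      have rk: "r t \<le> k (\<psi> (ln t))" if "t \<in> {0<..<b}" for t
      proof (cases "ln t \<le> u1")
        case True
        have "L \<le> \<psi> (ln t)"
        proof (cases "ln t = u1")
          case True
          then show ?thesis using lower[of "ln t"] lnB[OF that] line[of u1] by simp
        qed (use below[of "ln t"] \<open>ln t \<le> u1\<close> in simp)
        moreover have "\<psi> (ln t) \<le> max 0 ((C - ln t) / b)" using upper[OF True] by simp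
        ultimately show ?thesis unfolding r_def by (rule k_down)
      next
        case False
        then show ?thesis
          unfolding r_def using lower[of "ln t"] above[of "ln t"] lnB[OF that] nonneg[of "ln t"]
          by (intro k_up) (auto simp: B_def)
      qed
      \<comment> \<open>Both terms integrate to \<open>a / b * exp C\<close>, wherever the line
        happens to end.\<close>
      have "((\<lambda>t. (exp (a * min L ((C - ln t) / b)) - 1) - a / b * (C - ln t)) has_integral
          (a / b * exp C - a / b * exp C)) {0<..<exp C}"
        by (intro has_integral_diff trunc has_integral_mult_right has_integral_log_level)
      then have "((\<lambda>t. (exp (a * min L ((C - ln t) / b)) - 1) - a / b * (C - ln t)) has_integral 0) {0<..<exp C}"
        by simp
      then have "(r has_integral 0) {0<..<exp C}"
      proof (rule has_integral_eq[rotated])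
        fix t assume "t \<in> {0<..<exp C}"
        then have "ln t < C" by (metis greaterThanLessThan_iff ln_exp ln_less_cancel_iff exp_gt_zero)
        then show "exp (a * min L ((C - ln t) / b)) - 1 - a / b * (C - ln t) = r t"
          using \<open>0 < b\<close> by (simp add: r_def k_def)
      qed
      moreover have "(r has_integral 0) {exp C..b}"
      proof (rule has_integral_is_0)
        fix t assume t: "t \<in> {exp C..b}"
        then have "0 < t" by (metis atLeastAtMost_iff exp_gt_zero order_less_le_trans)
        then have "C \<le> ln t" using t by (simp add: ln_ge_iff)
        then have "(C - ln t) / b \<le> 0" using \<open>0 < b\<close> by (simp add: divide_nonpos_pos)
        then show "r t = 0" using L by (simp add: r_def k_def max_def)
      qed
      ultimately have "(r has_integral 0 + 0) {0..b}"
        using CB B exp_le_cancel_iff[of C B]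
        by (intro has_integral_combine[of 0 "exp C" b]) (auto simp: has_integral_Icc_iff_Ioo)
      then have r0: "(r has_integral 0) {0<..<b}" by (simp add: has_integral_Icc_iff_Ioo)
      have "((\<lambda>t. ?q t - a * \<psi> (ln t)) has_integral I - a * 1) {0<..<b}"
        by (intro has_integral_diff has_integral_mult_right I int)
      from has_integral_le[OF r0 this] rk have "0 \<le> I - a * 1"
        by (simp add: k_def)
      then show ?thesis by simp
    qed
  qed
  with I show ?thesis by blast
qed

section \<open>Superlevel sets of log-concave densities\<close>

lemma log_concave_fun_nonneg: "log_concave_fun f \<Longrightarrow> 0 \<le> f x"
  by (auto simp: log_concave_fun_def exp_minus_ext_def)

text \<open>In logarithmic levels, log-concavity is the convexity inequality for the potential
  \<open>V\<close>. Exceeding a positive level forces \<open>V\<close> to be finite at both points,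
  so real arithmetic applies.\<close>

lemma log_concave_fun_level_combination:
  assumes f: "log_concave_fun f" and x: "exp u < f x" and y: "exp v < f y" and t: "0 \<le> t" "t \<le> 1"
  shows "exp ((1 - t) * u + t * v) < f ((1 - t) * x + t * y)"
proof -
  obtain V where V: "convex_ext V" "\<And>x. f x = exp_minus_ext (V x)"
    using f by (auto simp: log_concave_fun_def)
  have finite: "\<exists>p. V z = ereal p \<and> f z = exp (- p)" if "exp w < f z" for w z
  proof -
    have "V z \<noteq> \<infinity>"
      using that V(2)[of z] exp_gt_zero[of w] by (auto simp: exp_minus_ext_def)
    moreover have "V z \<noteq> - \<infinity>" using V(1) by (simp add: convex_ext_def)
    ultimately obtain p where "V z = ereal p" by (cases "V z") auto
    then show ?thesis using V(2)[of z] by (simp add: exp_minus_ext_def)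
  qed
  obtain p q where p: "V x = ereal p" "f x = exp (- p)" and q: "V y = ereal q" "f y = exp (- q)"
    using finite[OF x] finite[OF y] by auto
  let ?z = "(1 - t) * x + t * y"
  have "V ?z \<le> ereal (1 - t) * V x + ereal t * V y" and "V ?z \<noteq> - \<infinity>"
    using V(1) t by (auto simp: convex_ext_def)
  then have "V ?z \<le> ereal ((1 - t) * p + t * q)" by (simp add: p q)
  with \<open>V ?z \<noteq> - \<infinity>\<close> obtain r where r: "V ?z = ereal r" "r \<le> (1 - t) * p + t * q"
    by (cases "V ?z") auto
  have "u < - p" "v < - q" using x y p q by auto
  then have "(1 - t) * u + t * v < (1 - t) * (- p) + t * (- q)"
  proof (cases "t = 0")
    case False
    with t \<open>u < - p\<close> \<open>v < - q\<close> show ?thesis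
      by (intro add_le_less_mono mult_left_mono mult_strict_left_mono) auto
  qed simp
  also have "\<dots> \<le> - r" using r by simp
  finally show ?thesis using V(2)[of ?z] r by (simp add: exp_minus_ext_def)
qed

text \<open>A convex set of reals is an interval. Two of its points are no farther apart than its
  measure, so finite measure makes it bounded; it then differs from \<open>{Inf S<..<Sup S}\<close>
  by endpoints at most.\<close>

lemma convex_real_fmeasurable:
  fixes S :: "real set"
  assumes cv: "convex S" and S: "S \<in> fmeasurable lborel"
  shows diff_le_measure: "\<And>x y. x \<in> S \<Longrightarrow> y \<in> S \<Longrightarrow> y - x \<le> measure lborel S"
    and convex_real_bounded: "bdd_below S" "bdd_above S"
    and Ioo_subset_convex_real: "S \<noteq> {} \<Longrightarrow> {Inf S<..<Sup S} \<subseteq> S"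
    and measure_convex_real: "S \<noteq> {} \<Longrightarrow> measure lborel S = Sup S - Inf S"
proof -
  have iv: "{x..y} \<subseteq> S" if "x \<in> S" "y \<in> S" for x y
    using mem_is_interval_1_I[of S x y] cv that by (auto simp: is_interval_convex_1)
  show diff: "y - x \<le> measure lborel S" if "x \<in> S" "y \<in> S" for x y
  proof (cases "x \<le> y")
    case True
    then have "y - x = measure lborel {x..y}" by simp
    also have "\<dots> \<le> measure lborel S"
      using S iv[OF that] by (intro measure_mono_fmeasurable) auto
    finally show ?thesis .
  qed (use measure_nonneg[of lborel S] in linarith)
  have "bdd_below S \<and> bdd_above S"
  proof (cases "S = {}")
    case False
    then obtain x where x: "x \<in> S" by auto
    have "x - measure lborel S \<le> y \<and> y \<le> x + measure lborel S" if "y \<in> S" for y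
      using diff[OF x that] diff[OF that x] by linarith
    then show ?thesis by (meson bdd_aboveI bdd_belowI)
  qed simp
  then show bdd: "bdd_below S" "bdd_above S" by auto
  show Ioo: "{Inf S<..<Sup S} \<subseteq> S" if ne: "S \<noteq> {}"
  proof
    fix z assume "z \<in> {Inf S<..<Sup S}"
    then obtain x y where "x \<in> S" "x < z" "y \<in> S" "z < y"
      using cInf_less_iff[OF ne bdd(1)] less_cSup_iff[OF ne bdd(2)] by auto
    then show "z \<in> S" using iv[of x y] by auto
  qed
  show "measure lborel S = Sup S - Inf S" if "S \<noteq> {}"
  proof (rule antisym)
    have le: "Inf S \<le> Sup S" by (rule cInf_le_cSup[OF that bdd(2,1)])
    have "measure lborel S \<le> measure lborel {Inf S..Sup S}"
      using bdd S fmeasurable_compact[of "{Inf S..Sup S}"]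
      by (intro measure_mono_fmeasurable) (auto intro: cInf_lower cSup_upper)
    then show "measure lborel S \<le> Sup S - Inf S" using le by simp
    have "measure lborel {Inf S<..<Sup S} \<le> measure lborel S"
      using Ioo[OF that] S by (intro measure_mono_fmeasurable) auto
    then show "Sup S - Inf S \<le> measure lborel S" using le by simp
  qed
qed

section \<open>Lengths of superlevel sets as a concave profile\<close>

locale log_concave_density =
  fixes f :: "real \<Rightarrow> real"
  assumes log_concave: "log_concave_fun f"
    and measurable_f [measurable]: "f \<in> borel_measurable borel"
    and nn_integral_f: "(\<integral>\<^sup>+x. ennreal (f x) \<partial>lborel) = 1"
begin

text \<open>Levels are indexed by their logarithm, the scale in which \<open>len\<close> is
  concave.\<close>

definition level :: "real \<Rightarrow> real set" where "level u = {x. exp u < f x}"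

definition len :: "real \<Rightarrow> real" where "len u = measure lborel (level u)"

definition peak :: real where "peak = enn2real (esssup lborel (\<lambda>x. ennreal (f x)))"

lemma nonneg: "0 \<le> f x"
  by (rule log_concave_fun_nonneg[OF log_concave])

lemma level_sets [measurable, simp]: "level u \<in> sets borel"
  unfolding level_def by measurable

lemma level_mono: "u \<le> v \<Longrightarrow> level v \<subseteq> level u"
  unfolding level_def by (auto intro: order_le_less_trans)

lemma convex_level: "convex (level u)"
  unfolding convex_alt level_def
  using log_concave_fun_level_combination[OF log_concave, of u _ u]
  by (auto simp: algebra_simps)

text \<open>Markov's inequality for a density of total mass 1.\<close>

lemma emeasure_level_le: "emeasure lborel (level u) \<le> ennreal (exp (- u))"
proof -
  have "ennreal (exp u) * emeasure lborel (level u) = (\<integral>\<^sup>+x. ennreal (exp u) * indicator (level u) x \<partial>lborel)"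
    by (rule nn_integral_cmult_indicator[symmetric]) simp
  also have "\<dots> \<le> (\<integral>\<^sup>+x. ennreal (f x) \<partial>lborel)"
    by (intro nn_integral_mono) (auto simp: level_def indicator_def intro!: ennreal_leI)
  finally have "ennreal (exp (- u)) * (ennreal (exp u) * emeasure lborel (level u)) \<le> ennreal (exp (- u)) * 1"
    unfolding nn_integral_f by (rule mult_left_mono) simp
  then show ?thesis
    by (simp add: mult.assoc[symmetric] ennreal_mult'[symmetric] exp_minus)
qed

lemma fmeasurable_level: "level u \<in> fmeasurable lborel"
  using emeasure_level_le[of u] by (intro fmeasurableI) (auto simp: order_le_less_trans)

lemma emeasure_level: "emeasure lborel (level u) = ennreal (len u)"
  unfolding len_def by (rule emeasure_eq_measure2[OF fmeasurable_level])

lemma len_nonneg: "0 \<le> len u"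
  by (simp add: len_def)

lemma len_antimono: "u \<le> v \<Longrightarrow> len v \<le> len u"
  unfolding len_def using level_mono fmeasurable_level
  by (intro measure_mono_fmeasurable) auto

lemma len_le: "len u \<le> exp (- u)"
  using emeasure_level_le[of u] by (simp add: emeasure_level)

text \<open>Brunn-Minkowski on the line: the combination of the two level sets lies in the level set
  of the combined level, so suprema and infima combine accordingly. They need not be attained, so
  the bounds are taken in one variable at a time, with zero weights treated separately.\<close>

lemma len_combination:
  assumes ne: "level u \<noteq> {}" "level v \<noteq> {}" and t: "0 \<le> t" "t \<le> 1"
  shows "(1 - t) * len u + t * len v \<le> len ((1 - t) * u + t * v)"
proof -
  let ?W = "level ((1 - t) * u + t * v)"
  note fin = convex_real_fmeasurable[OF convex_level fmeasurable_level]
  have comb: "(1 - t) * x + t * y \<in> ?W" if "x \<in> level u" "y \<in> level v" for x y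
    using that log_concave_fun_level_combination[OF log_concave _ _ t] by (auto simp: level_def)
  have W_ne: "?W \<noteq> {}" using ne comb by blast
  have up: "(1 - t) * x + t * Sup (level v) \<le> Sup ?W" if "x \<in> level u" for x
  proof (cases "t = 0")
    case True
    then show ?thesis using ne comb[OF that] fin(3) by (auto intro: cSup_upper)
  next
    case False
    have "Sup (level v) \<le> (Sup ?W - (1 - t) * x) / t"
    proof (rule cSup_least[OF ne(2)])
      fix y assume "y \<in> level v"
      then have "(1 - t) * x + t * y \<le> Sup ?W" using comb that fin(3) by (intro cSup_upper) auto
      then show "y \<le> (Sup ?W - (1 - t) * x) / t" using False t by (simp add: field_simps)
    qed
    then show ?thesis using False t by (simp add: field_simps)
  qed
  have up': "(1 - t) * Sup (level u) + t * Sup (level v) \<le> Sup ?W"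
  proof (cases "t = 1")
    case True
    then show ?thesis using ne up by auto
  next
    case False
    have "Sup (level u) \<le> (Sup ?W - t * Sup (level v)) / (1 - t)"
    proof (rule cSup_least[OF ne(1)])
      fix x assume "x \<in> level u"
      from up[OF this] show "x \<le> (Sup ?W - t * Sup (level v)) / (1 - t)"
        using False t by (simp add: field_simps)
    qed
    then show ?thesis using False t by (simp add: field_simps)
  qed
  have lo: "Inf ?W \<le> (1 - t) * x + t * Inf (level v)" if "x \<in> level u" for x
  proof (cases "t = 0")
    case True
    then show ?thesis using ne comb[OF that] fin(2) by (auto intro: cInf_lower)
  next
    case False
    have "(Inf ?W - (1 - t) * x) / t \<le> Inf (level v)"
    proof (rule cInf_greatest[OF ne(2)])
      fix y assume "y \<in> level v"
      then have "Inf ?W \<le> (1 - t) * x + t * y" using comb that fin(2) by (intro cInf_lower) auto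
      then show "(Inf ?W - (1 - t) * x) / t \<le> y" using False t by (simp add: field_simps)
    qed
    then show ?thesis using False t by (simp add: field_simps)
  qed
  have lo': "Inf ?W \<le> (1 - t) * Inf (level u) + t * Inf (level v)"
  proof (cases "t = 1")
    case True
    then show ?thesis using ne lo by auto
  next
    case False
    have "(Inf ?W - t * Inf (level v)) / (1 - t) \<le> Inf (level u)"
    proof (rule cInf_greatest[OF ne(1)])
      fix x assume "x \<in> level u"
      from lo[OF this] show "(Inf ?W - t * Inf (level v)) / (1 - t) \<le> x"
        using False t by (simp add: field_simps)
    qed
    then show ?thesis using False t by (simp add: field_simps)
  qed
  show ?thesis
    using up' lo' unfolding len_def fin(5)[OF ne(1)] fin(5)[OF ne(2)] fin(5)[OF W_ne]
    by (simp add: algebra_simps)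
qed

lemma len_eq_0_iff: "len u = 0 \<longleftrightarrow> emeasure lborel (level u) = 0"
  by (simp add: emeasure_level ennreal_eq_0_iff len_nonneg antisym_conv)

lemma len_pos_iff: "0 < len u \<longleftrightarrow> ennreal (exp u) < esssup lborel (\<lambda>x. ennreal (f x))"
proof -
  have eq: "{x \<in> space lborel. ennreal (exp u) < ennreal (f x)} = level u"
    by (auto simp: level_def ennreal_less_iff)
  show ?thesis
  proof
    assume pos: "0 < len u"
    show "ennreal (exp u) < esssup lborel (\<lambda>x. ennreal (f x))"
    proof (rule ccontr)
      assume "\<not> ennreal (exp u) < esssup lborel (\<lambda>x. ennreal (f x))"
      then have le: "esssup lborel (\<lambda>x. ennreal (f x)) \<le> ennreal (exp u)" by simp
      have "AE x in lborel. ennreal (f x) \<le> ennreal (exp u)"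
        using esssup_AE[of "\<lambda>x. ennreal (f x)" lborel]
        by eventually_elim (rule order_trans[OF _ le])
      then have "AE x in lborel. x \<notin> level u"
        by eventually_elim (simp add: level_def ennreal_le_iff not_less)
      then have "emeasure lborel (level u) = 0"
        by (subst (asm) AE_iff_measurable[of "level u"]) auto
      then show False using pos len_eq_0_iff[of u] by simp
    qed
  next
    assume "ennreal (exp u) < esssup lborel (\<lambda>x. ennreal (f x))"
    from esssup_pos_measure[OF _ this] show "0 < len u"
      unfolding eq using len_eq_0_iff[of u] len_nonneg[of u] by (simp add: less_le)
  qed
qed

lemma level_nonempty: "0 < len u \<Longrightarrow> level u \<noteq> {}"
  by (auto simp: len_def)

lemma peak_pos: "0 < peak"
  and esssup_eq_peak: "esssup lborel (\<lambda>x. ennreal (f x)) = ennreal peak"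
proof -
  let ?s = "esssup lborel (\<lambda>x. ennreal (f x))"
  have s0: "?s \<noteq> 0"
  proof
    assume "?s = 0"
    then have "AE x in lborel. ennreal (f x) = 0"
      using esssup_AE[of "\<lambda>x. ennreal (f x)" lborel] by simp
    then have "(\<integral>\<^sup>+x. ennreal (f x) \<partial>lborel) = 0" by (simp add: nn_integral_0_iff_AE)
    then show False using nn_integral_f by simp
  qed
  have stop: "?s \<noteq> \<infinity>"
  proof
    assume inf: "?s = \<infinity>"
    then have pos: "0 < len u" for u by (simp add: len_pos_iff)
    \<comment> \<open>If \<open>f\<close> were unbounded, then by midpoint concavity \<open>len\<close> could not decay.\<close>
    have half: "len 0 / 2 \<le> len u" for u
      using len_combination[of 0 "2 * u" "1/2"] level_nonempty[OF pos] len_nonneg[of "2 * u"] by simp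
    \<comment> \<open>At the level \<open>- ln (len 0 / 4)\<close> the bound
      \<open>exp (- u)\<close> is a quarter of \<open>len 0\<close>, below the half just
      obtained.\<close>
    have "exp (- (- ln (len 0 / 4))) = len 0 / 4" using pos[of 0] by simp
    then have "len (- ln (len 0 / 4)) \<le> len 0 / 4"
      using len_le[of "- ln (len 0 / 4)"] by simp
    with half[of "- ln (len 0 / 4)"] pos[of 0] show False by simp
  qed
  show "0 < peak" "?s = ennreal peak"
    using s0 stop by (auto simp: peak_def enn2real_positive_iff less_top zero_less_iff_neq_zero)
qed

lemma len_pos: "u < ln peak \<Longrightarrow> 0 < len u"
proof -
  assume "u < ln peak"
  then have "exp u < peak" using peak_pos by (metis exp_less_cancel_iff exp_ln)
  then show ?thesis unfolding len_pos_iff esssup_eq_peak by (simp add: ennreal_less_iff)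
qed

lemma len_eq_0: "ln peak \<le> u \<Longrightarrow> len u = 0"
proof -
  assume "ln peak \<le> u"
  then have "peak \<le> exp u" using peak_pos by (metis exp_le_cancel_iff exp_ln)
  then have "\<not> 0 < len u" unfolding len_pos_iff esssup_eq_peak by (simp add: ennreal_leI not_less)
  then show ?thesis using len_nonneg[of u] by simp
qed

lemma concave_len: "concave_on {..<ln peak} len"
  unfolding concave_on_def
proof (rule convex_onI)
  fix t x y :: real
  assume "0 < t" "t < 1" "x \<in> {..<ln peak}" "y \<in> {..<ln peak}"
  then show "- len ((1 - t) *\<^sub>R x + t *\<^sub>R y) \<le> (1 - t) * - len x + t * - len y"
    using len_combination[OF level_nonempty[OF len_pos] level_nonempty[OF len_pos], of x y t] by simp
qed simp

lemma measurable_len [measurable]: "len \<in> borel_measurable borel"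
proof -
  have "(\<lambda>u. - len u) \<in> borel_measurable borel"
    by (rule borel_measurable_mono) (simp add: mono_def len_antimono)
  then show ?thesis by simp
qed

lemma layer_cake: "ennreal (f x) = (\<integral>\<^sup>+s. (if 0 < s \<and> s < f x then 1 else 0) \<partial>lborel)"
proof -
  have "(\<integral>\<^sup>+s. (if 0 < s \<and> s < f x then 1 else 0) \<partial>lborel) = (\<integral>\<^sup>+s. indicator {0<..<f x} s \<partial>lborel)"
    by (intro nn_integral_cong) (auto simp: indicator_def)
  then show ?thesis by (simp add: nonneg)
qed

text \<open>Tonelli's theorem applied to the layer-cake formula; levels at or above the peak
  contribute nothing.\<close>

lemma has_integral_len: "((\<lambda>s. len (ln s)) has_integral 1) {0<..<peak}"
proof -
  have "1 = (\<integral>\<^sup>+x. \<integral>\<^sup>+s. (if 0 < s \<and> s < f x then 1 else 0) \<partial>lborel \<partial>lborel)"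
    using nn_integral_f by (simp only: layer_cake)
  also have "\<dots> = (\<integral>\<^sup>+s. \<integral>\<^sup>+x. (if 0 < s \<and> s < f x then 1 else 0) \<partial>lborel \<partial>lborel)"
    by (intro lborel_pair.Fubini') measurable
  also have "\<dots> = (\<integral>\<^sup>+s. ennreal (len (ln s) * indicator {0<..<peak} s) \<partial>lborel)"
  proof (rule nn_integral_cong)
    fix s :: real
    show "(\<integral>\<^sup>+x. (if 0 < s \<and> s < f x then 1 else 0) \<partial>lborel)
        = ennreal (len (ln s) * indicator {0<..<peak} s)"
    proof (cases "0 < s")
      case True
      then have "(\<integral>\<^sup>+x. (if 0 < s \<and> s < f x then 1 else 0) \<partial>lborel)
          = (\<integral>\<^sup>+x. indicator (level (ln s)) x \<partial>lborel)"
        by (intro nn_integral_cong) (auto simp: level_def indicator_def)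
      also have "\<dots> = ennreal (len (ln s))" by (simp add: emeasure_level)
      also have "len (ln s) = len (ln s) * indicator {0<..<peak} s"
        using True len_eq_0[of "ln s"] peak_pos by (auto simp: indicator_def not_less)
      finally show ?thesis .
    qed simp
  qed
  finally have eq: "(\<integral>\<^sup>+s. ennreal (len (ln s) * indicator {0<..<peak} s) \<partial>lborel) = ennreal 1"
    by simp
  have "has_bochner_integral lborel (\<lambda>s. len (ln s) * indicator {0<..<peak} s) 1"
    by (rule has_bochner_integral_nn_integral[OF _ _ _ eq]) (auto simp: len_nonneg)
  then have "((\<lambda>s. len (ln s) * indicator {0<..<peak} s) has_integral 1) UNIV"
    using has_integral_integral_lborel by (metis has_bochner_integral_iff)
  then have "((\<lambda>s. if s \<in> {0<..<peak} then len (ln s) else 0) has_integral 1) UNIV"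
    by (rule has_integral_eq[rotated]) (auto simp: indicator_def)
  then show ?thesis by (simp only: has_integral_restrict_UNIV)
qed

text \<open>One window \<open>{c..c + L}\<close> serves all levels: level intervals no longer than
  \<open>L\<close> lie in it up to endpoints, and longer ones cover its interior. No level set need
  have length exactly \<open>L\<close>.\<close>

lemma exists_window:
  assumes "0 < L"
  shows "\<exists>c. \<forall>u<ln peak. \<exists>i. c \<le> i \<and> i + min L (len u) \<le> c + L \<and> {i<..<i + min L (len u)} \<subseteq> level u"
proof -
  note fin = convex_real_fmeasurable[OF convex_level fmeasurable_level]
  define l r where "l = (\<lambda>u. Inf (level u))" and "r = (\<lambda>u. Sup (level u))"
  have ne: "level u \<noteq> {}" if "u < ln peak" for u
    using level_nonempty[OF len_pos[OF that]] .
  have len: "len u = r u - l u" if "u < ln peak" for u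
    using fin(5)[OF ne[OF that]] by (simp add: len_def l_def r_def)
  have nest_l: "l u \<le> l v" if "u \<le> v" "v < ln peak" for u v
    unfolding l_def by (rule cInf_superset_mono[OF ne[OF that(2)] fin(2) level_mono[OF that(1)]])
  have nest_r: "r v \<le> r u" if "u \<le> v" "v < ln peak" for u v
    unfolding r_def by (rule cSup_subset_mono[OF ne[OF that(2)] fin(3) level_mono[OF that(1)]])
  \<comment> \<open>At level \<open>u\<close> the requirement on \<open>c\<close> is
    \<open>lo u \<le> c \<le> hi u\<close>. Nestedness makes these constraint intervals meet
    pairwise, so the supremum of all \<open>lo\<close> meets every one, as in Helly's theorem on the
    line.\<close>
  define lo hi where "lo = (\<lambda>u. if len u \<le> L then r u - L else l u)"
    and "hi = (\<lambda>u. if len u \<le> L then l u else r u - L)"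
  have le: "lo u \<le> hi v" if "u < ln peak" "v < ln peak" for u v
  proof (cases "u \<le> v")
    case True
    then show ?thesis
      using nest_l[of u v] nest_r[of u v] True len[of u] len[of v] that by (auto simp: lo_def hi_def)
  next
    case False
    then show ?thesis
      using nest_l[of v u] nest_r[of v u] len[of u] len[of v] that by (auto simp: lo_def hi_def)
  qed
  define c where "c = (SUP u\<in>{..<ln peak}. lo u)"
  have I: "ln peak - 1 \<in> {..<ln peak}" by simp
  have c: "lo u \<le> c" "c \<le> hi u" if "u < ln peak" for u
  proof -
    have "bdd_above (lo ` {..<ln peak})"
      using le[of _ "ln peak - 1"] by (auto simp: bdd_above_def)
    then show "lo u \<le> c" unfolding c_def using that by (intro cSUP_upper) auto
    show "c \<le> hi u" unfolding c_def using I le that by (intro cSUP_least) auto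
  qed
  have "\<exists>i. c \<le> i \<and> i + min L (len u) \<le> c + L \<and> {i<..<i + min L (len u)} \<subseteq> level u"
    if u: "u < ln peak" for u
  proof -
    have sub: "{l u<..<r u} \<subseteq> level u" using fin(4)[OF ne[OF u]] by (simp add: l_def r_def)
    show ?thesis
    proof (cases "len u \<le> L")
      case True
      then show ?thesis
        using c[OF u] len[OF u] sub by (intro exI[of _ "l u"]) (auto simp: lo_def hi_def)
    next
      case False
      then show ?thesis
        using c[OF u] sub by (intro exI[of _ c]) (force simp: lo_def hi_def)
    qed
  qed
  then show ?thesis by blast
qed

end

section \<open>Essential supremum of a convolution\<close>

lemma AE_lborel_Ioo_witness:
  fixes z e :: real
  assumes "AE x in lborel. P x" "0 < e"
  shows "\<exists>x\<in>{z<..<z + e}. P x"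
proof (rule ccontr)
  assume "\<not> ?thesis"
  then have "AE x in lborel. x \<notin> {z<..<z + e}"
    using assms(1) by (auto elim!: eventually_mono)
  then have "emeasure lborel {z<..<z + e} = 0"
    by (subst (asm) AE_iff_measurable[of "{z<..<z + e}"]) auto
  then show False using \<open>0 < e\<close> by simp
qed

text \<open>A value at a single point says nothing about an essential supremum. A linear error bound
  to the right of \<open>z\<close> suffices, since points with \<open>h x\<close> at most the
  essential supremum exist arbitrarily close to \<open>z\<close> on that side.\<close>

lemma esssup_ge_right_limit:
  fixes h :: "real \<Rightarrow> ennreal" and T C z :: real
  assumes "0 \<le> T" "0 \<le> C" and h: "\<And>d. 0 < d \<Longrightarrow> ennreal T \<le> h (z + d) + ennreal (C * d)"
  shows "ennreal T \<le> esssup lborel h"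
proof (cases "esssup lborel h")
  case (real r)
  have "T \<le> r"
  proof (rule field_le_epsilon)
    fix e :: real assume "0 < e"
    define d where "d = e / (C + 1)"
    have "0 < d" using \<open>0 < e\<close> \<open>0 \<le> C\<close> by (simp add: d_def)
    obtain x where x: "z < x" "x < z + d" "h x \<le> ennreal r"
      using AE_lborel_Ioo_witness[OF esssup_AE[of h lborel] \<open>0 < d\<close>, of z] real by auto
    have "ennreal T \<le> ennreal r + ennreal (C * (x - z))"
      using h[of "x - z"] x by (auto intro: order_trans add_right_mono)
    then have "T \<le> r + C * (x - z)"
      using x real \<open>0 \<le> C\<close> by (simp add: ennreal_plus[symmetric] del: ennreal_plus)
    also have "C * (x - z) \<le> (C + 1) * d"
      using x \<open>0 \<le> C\<close> by (intro mult_mono) auto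
    also have "(C + 1) * d = e" using \<open>0 \<le> C\<close> by (simp add: d_def)
    finally show "T \<le> r + e" by simp
  qed
  then show ?thesis using real by (simp add: ennreal_leI)
qed simp

section \<open>Convolutions as overlaps of superlevel sets\<close>

definition convolution :: "(real \<Rightarrow> real) \<Rightarrow> (real \<Rightarrow> real) \<Rightarrow> real \<Rightarrow> ennreal" where
  "convolution f g x = (\<integral>\<^sup>+y. ennreal (f (x - y)) * ennreal (g y) \<partial>lborel)"

lemma convolution_commute:
  assumes [measurable]: "f \<in> borel_measurable borel" "g \<in> borel_measurable borel"
  shows "convolution f g = convolution g f"
proof
  fix x
  show "convolution f g x = convolution g f x"
    unfolding convolution_def
    by (subst nn_integral_real_affine[where c = "-1" and t = x]) (auto simp: mult.commute)
qed

text \<open>The maximal density of a sum of independent exponentials with rates \<open>a\<close> and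
  \<open>b\<close>. At the mode, \<open>a * b / (b - a) * (exp (- a * x) - exp (- b * x))\<close>
  reduces to this by the first-order condition when \<open>a < b\<close>.\<close>

definition exponential_sum_peak :: "real \<Rightarrow> real \<Rightarrow> real" where
  "exponential_sum_peak a b = min a b * exp (- min a b * optimal_shift (min a b) (max a b))"

context
  fixes f g :: "real \<Rightarrow> real"
  assumes f: "log_concave_density f" and g: "log_concave_density g"
begin

interpretation F: log_concave_density f by (rule f)
interpretation G: log_concave_density g by (rule g)

text \<open>For positive levels the innermost integral is the length in which a superlevel set of
  \<open>f\<close>, reflected by \<open>y \<mapsto> z - y\<close>, meets one of
  \<open>g\<close>.\<close>

lemma convolution_layer_cake:
  "convolution f g z = (\<integral>\<^sup>+t. \<integral>\<^sup>+s. \<integral>\<^sup>+y.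
    (if 0 < s \<and> s < f (z - y) then 1 else 0) * (if 0 < t \<and> t < g y then 1 else 0) \<partial>lborel \<partial>lborel \<partial>lborel)"
proof -
  define p :: "real \<Rightarrow> real \<Rightarrow> ennreal" where "p = (\<lambda>s x. if 0 < s \<and> s < f x then 1 else 0)"
  define q :: "real \<Rightarrow> real \<Rightarrow> ennreal" where "q = (\<lambda>t x. if 0 < t \<and> t < g x then 1 else 0)"
  have [measurable]: "case_prod p \<in> borel_measurable (borel \<Otimes>\<^sub>M borel)"
    unfolding p_def by measurable
  have [measurable]: "case_prod q \<in> borel_measurable (borel \<Otimes>\<^sub>M borel)"
    unfolding q_def by measurable
  have fp: "ennreal (f x) = (\<integral>\<^sup>+s. p s x \<partial>lborel)" for x unfolding p_def by (rule F.layer_cake)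
  have gq: "ennreal (g x) = (\<integral>\<^sup>+s. q s x \<partial>lborel)" for x unfolding q_def by (rule G.layer_cake)
  have "convolution f g z = (\<integral>\<^sup>+y. \<integral>\<^sup>+t. ennreal (f (z - y)) * q t y \<partial>lborel \<partial>lborel)"
    unfolding convolution_def gq by (intro nn_integral_cong nn_integral_cmult[symmetric]) measurable
  also have "\<dots> = (\<integral>\<^sup>+t. \<integral>\<^sup>+y. ennreal (f (z - y)) * q t y \<partial>lborel \<partial>lborel)"
    by (intro lborel_pair.Fubini') measurable
  also have "\<dots> = (\<integral>\<^sup>+t. \<integral>\<^sup>+s. \<integral>\<^sup>+y. p s (z - y) * q t y \<partial>lborel \<partial>lborel \<partial>lborel)"
  proof (rule nn_integral_cong)
    fix t :: real
    have "(\<integral>\<^sup>+y. ennreal (f (z - y)) * q t y \<partial>lborel) = (\<integral>\<^sup>+y. \<integral>\<^sup>+s. p s (z - y) * q t y \<partial>lborel \<partial>lborel)"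
      unfolding fp by (intro nn_integral_cong nn_integral_multc[symmetric]) measurable
    also have "\<dots> = (\<integral>\<^sup>+s. \<integral>\<^sup>+y. p s (z - y) * q t y \<partial>lborel \<partial>lborel)"
      by (intro lborel_pair.Fubini') measurable
    finally show "(\<integral>\<^sup>+y. ennreal (f (z - y)) * q t y \<partial>lborel)
        = (\<integral>\<^sup>+s. \<integral>\<^sup>+y. p s (z - y) * q t y \<partial>lborel \<partial>lborel)" .
  qed
  finally show ?thesis by (simp only: p_def q_def)
qed

text \<open>Aligning two superlevel intervals of the same length \<open>L\<close>, any two superlevel intervals of
  \<open>f\<close> and of the reflected \<open>g\<close> overlap at least as much as if all of them were one-sided.\<close>

lemma level_overlap:
  assumes "0 < L"
  obtains z0 where "\<And>s t d. \<lbrakk>0 < s; s < F.peak; 0 < t; t < G.peak\<rbrakk> \<Longrightarrow>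
    ennreal (max 0 (min L (F.len (ln s)) + min L (G.len (ln t)) - L))
    \<le> (\<integral>\<^sup>+y. (if 0 < s \<and> s < f (z0 + d - y) then 1 else 0) * (if 0 < t \<and> t < g y then 1 else 0) \<partial>lborel)
      + ennreal \<bar>d\<bar>"
proof -
  obtain c where c: "\<forall>u<ln F.peak. \<exists>i. c \<le> i \<and> i + min L (F.len u) \<le> c + L \<and>
      {i<..<i + min L (F.len u)} \<subseteq> F.level u"
    using F.exists_window[OF assms] by blast
  obtain e where e: "\<forall>u<ln G.peak. \<exists>i. e \<le> i \<and> i + min L (G.len u) \<le> e + L \<and>
      {i<..<i + min L (G.len u)} \<subseteq> G.level u"
    using G.exists_window[OF assms] by blast
  \<comment> \<open>Reflection by \<open>y \<mapsto> c + e + L - y\<close> carries the window of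
    \<open>f\<close> onto that of \<open>g\<close>. Displacing the point by \<open>d\<close> costs
    at most the length \<open>\<bar>d\<bar>\<close> of overlap.\<close>
  have "ennreal (max 0 (min L (F.len (ln s)) + min L (G.len (ln t)) - L))
    \<le> (\<integral>\<^sup>+y. (if 0 < s \<and> s < f (c + e + L + d - y) then 1 else 0) * (if 0 < t \<and> t < g y then 1 else 0) \<partial>lborel)
      + ennreal \<bar>d\<bar>"
    if s: "0 < s" "s < F.peak" and t: "0 < t" "t < G.peak" for s t d
  proof -
    define \<alpha> \<beta> where "\<alpha> = min L (F.len (ln s))" and "\<beta> = min L (G.len (ln t))"
    have \<alpha>: "0 \<le> \<alpha>" "\<alpha> \<le> L" and \<beta>: "0 \<le> \<beta>" "\<beta> \<le> L"
      using assms F.len_nonneg G.len_nonneg by (auto simp: \<alpha>_def \<beta>_def)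
    have "ln s < ln F.peak" "ln t < ln G.peak" using s t by auto
    then obtain i j where i: "c \<le> i" "i + \<alpha> \<le> c + L" "{i<..<i + \<alpha>} \<subseteq> F.level (ln s)"
      and j: "e \<le> j" "j + \<beta> \<le> e + L" "{j<..<j + \<beta>} \<subseteq> G.level (ln t)"
      using c e unfolding \<alpha>_def \<beta>_def by meson
    define z where "z = c + e + L + d"
    define lo hi where "lo = max (z - i - \<alpha>) j" and "hi = min (z - i) (j + \<beta>)"
    have gap: "\<alpha> + \<beta> - L \<le> (hi - lo) + \<bar>d\<bar>"
      using \<alpha> \<beta> i(1,2) j(1,2) unfolding lo_def hi_def z_def by linarith
    let ?ov = "\<integral>\<^sup>+y. (if 0 < s \<and> s < f (z - y) then 1 else 0) * (if 0 < t \<and> t < g y then 1 else 0) \<partial>lborel"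
    have "indicator {lo<..<hi} y
        \<le> (if 0 < s \<and> s < f (z - y) then 1 else 0) * (if 0 < t \<and> t < g y then 1 else (0::ennreal))" for y
    proof (cases "y \<in> {lo<..<hi}")
      case True
      then have "z - y \<in> {i<..<i + \<alpha>}" "y \<in> {j<..<j + \<beta>}" by (auto simp: lo_def hi_def)
      then have "z - y \<in> F.level (ln s)" "y \<in> G.level (ln t)" using i j by auto
      then show ?thesis using s t True by (simp add: F.level_def G.level_def)
    qed simp
    then have "(\<integral>\<^sup>+y. indicator {lo<..<hi} y \<partial>lborel) \<le> ?ov"
      by (intro nn_integral_mono)
    then have ov: "emeasure lborel {lo<..<hi} \<le> ?ov" by simp
    have "ennreal (max 0 (\<alpha> + \<beta> - L)) \<le> emeasure lborel {lo<..<hi} + ennreal \<bar>d\<bar>"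
    proof (cases "lo \<le> hi")
      case True
      then have "emeasure lborel {lo<..<hi} + ennreal \<bar>d\<bar> = ennreal (hi - lo + \<bar>d\<bar>)" by simp
      then show ?thesis using gap True by (simp add: ennreal_leI del: ennreal_plus)
    next
      case False
      then show ?thesis using gap by (auto intro!: ennreal_leI)
    qed
    also have "\<dots> \<le> ?ov + ennreal \<bar>d\<bar>" by (rule add_right_mono[OF ov])
    finally show ?thesis by (simp only: \<alpha>_def \<beta>_def z_def)
  qed
  then show thesis by (rule that)
qed

text \<open>The density with the smaller peak \<open>a\<close> takes the pointwise Jensen bound, for
  which \<open>L \<le> 1 / a\<close>. Integrating over its levels turns the overlap into a truncated
  exponential of the other profile, to which the single-crossing estimate applies.\<close>

lemma convolution_esssup_ge_ordered:
  assumes ab: "F.peak \<le> G.peak"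
  shows "ennreal (F.peak * exp (- F.peak * optimal_shift F.peak G.peak)) \<le> esssup lborel (convolution f g)"
proof -
  define a b L where "a = F.peak" and "b = G.peak" and "L = optimal_shift a b"
  have a: "0 < a" "a \<le> b" "0 < b"
    using F.peak_pos G.peak_pos ab by (auto simp: a_def b_def)
  have L: "0 < L" "L \<le> 1 / a" using optimal_shift[OF a(1,2)] by (auto simp: L_def)
  define \<Phi> where "\<Phi> = (\<lambda>s t. max 0 (min L (F.len (ln s)) + min L (G.len (ln t)) - L))"
  have [measurable]: "case_prod \<Phi> \<in> borel_measurable (borel \<Otimes>\<^sub>M borel)"
    unfolding \<Phi>_def by measurable
  obtain I where I: "a \<le> I" "((\<lambda>t. exp (a * min L (G.len (ln t))) - 1) has_integral I) {0<..<b}"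
    using profile_truncated_exp_integral[OF a(1,2) G.measurable_len, folded L_def]
      G.concave_len G.len_nonneg G.len_antimono G.has_integral_len by (auto simp: b_def)
  have inner: "ennreal (exp (- a * L) * (exp (a * min L (G.len (ln t))) - 1)) * indicator {0<..<b} t
      \<le> (\<integral>\<^sup>+s. ennreal (\<Phi> s t) * indicator {0<..<a} s * indicator {0<..<b} t \<partial>lborel)" for t
  proof -
    let ?y = "min L (G.len (ln t))"
    have y: "0 \<le> ?y" "?y \<le> L" using L G.len_nonneg by auto
    have "ennreal (exp (- a * L) * (exp (a * ?y) - 1))
        = (\<integral>\<^sup>+s. ennreal (max 0 (min L ((ln a - ln s) / a) + ?y - L)) * indicator {0<..<a} s \<partial>lborel)"
      by (rule nn_integral_has_integral_lebesgue'[symmetric])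
        (use has_integral_truncated_log_level[OF a(1) y] in auto)
    also have "\<dots> \<le> (\<integral>\<^sup>+s. ennreal (\<Phi> s t) * indicator {0<..<a} s \<partial>lborel)"
    proof (rule nn_integral_mono)
      fix s :: real
      have "min L ((ln a - ln s) / a) \<le> min L (F.len (ln s))" if "s \<in> {0<..<a}"
        using profile_lower_bound[of "ln a" F.len "ln s"] that a L F.concave_len F.len_nonneg
          F.len_antimono F.has_integral_len by (auto simp: a_def)
      then show "ennreal (max 0 (min L ((ln a - ln s) / a) + ?y - L)) * indicator {0<..<a} s
          \<le> ennreal (\<Phi> s t) * indicator {0<..<a} s"
        by (cases "s \<in> {0<..<a}") (auto simp: \<Phi>_def intro!: ennreal_leI)
    qed
    finally show ?thesis by (cases "t \<in> {0<..<b}") auto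
  qed
  have "ennreal (a * exp (- a * L)) \<le> ennreal (exp (- a * L) * I)"
    using I by (intro ennreal_leI) (simp add: mult.commute)
  also have "\<dots> = (\<integral>\<^sup>+t. ennreal (exp (- a * L) * (exp (a * min L (G.len (ln t))) - 1)) * indicator {0<..<b} t \<partial>lborel)"
    by (rule nn_integral_has_integral_lebesgue'[symmetric])
      (use has_integral_mult_right[OF I(2), of "exp (- a * L)"] a L G.len_nonneg in auto)
  also have "\<dots> \<le> (\<integral>\<^sup>+t. \<integral>\<^sup>+s. ennreal (\<Phi> s t) * indicator {0<..<a} s * indicator {0<..<b} t \<partial>lborel \<partial>lborel)"
    by (intro nn_integral_mono inner)
  finally have lower: "ennreal (a * exp (- a * L)) \<le> \<dots>" .
  obtain z0 where z0: "\<And>s t d. \<lbrakk>0 < s; s < a; 0 < t; t < b\<rbrakk> \<Longrightarrow>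
      ennreal (\<Phi> s t)
      \<le> (\<integral>\<^sup>+y. (if 0 < s \<and> s < f (z0 + d - y) then 1 else 0) * (if 0 < t \<and> t < g y then 1 else 0) \<partial>lborel)
        + ennreal \<bar>d\<bar>"
    unfolding \<Phi>_def a_def b_def using level_overlap[OF L(1)] by blast
  \<comment> \<open>The displacement costs at most \<open>d\<close> for each pair of levels, and the
    pairs fill a rectangle of area \<open>a * b\<close>.\<close>
  have "ennreal (a * exp (- a * L)) \<le> convolution f g (z0 + d) + ennreal (a * b * d)" if "0 < d" for d
  proof -
    let ?ov = "\<lambda>t s. \<integral>\<^sup>+y. (if 0 < s \<and> s < f (z0 + d - y) then 1 else 0) * (if 0 < t \<and> t < g y then 1 else 0) \<partial>lborel"
    have "(\<integral>\<^sup>+t. \<integral>\<^sup>+s. ennreal (\<Phi> s t) * indicator {0<..<a} s * indicator {0<..<b} t \<partial>lborel \<partial>lborel)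
        \<le> (\<integral>\<^sup>+t. \<integral>\<^sup>+s. ?ov t s + ennreal d * indicator {0<..<a} s * indicator {0<..<b} t \<partial>lborel \<partial>lborel)"
    proof (intro nn_integral_mono)
      fix t s :: real
      show "ennreal (\<Phi> s t) * indicator {0<..<a} s * indicator {0<..<b} t
          \<le> ?ov t s + ennreal d * indicator {0<..<a} s * indicator {0<..<b} t"
        using z0[of s t d] that by (auto simp: indicator_def)
    qed
    also have "\<dots> = (\<integral>\<^sup>+t. (\<integral>\<^sup>+s. ?ov t s \<partial>lborel) + ennreal d * ennreal a * indicator {0<..<b} t \<partial>lborel)"
    proof (rule nn_integral_cong)
      fix t :: real
      have "(\<integral>\<^sup>+s. ennreal d * indicator {0<..<a} s * indicator {0<..<b} t \<partial>lborel)
          = ennreal d * ennreal a * indicator {0<..<b} t"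
        using a by (simp add: nn_integral_multc nn_integral_cmult)
      then show "(\<integral>\<^sup>+s. ?ov t s + ennreal d * indicator {0<..<a} s * indicator {0<..<b} t \<partial>lborel)
          = (\<integral>\<^sup>+s. ?ov t s \<partial>lborel) + ennreal d * ennreal a * indicator {0<..<b} t"
        by (subst nn_integral_add) auto
    qed
    also have "\<dots> = convolution f g (z0 + d) + ennreal d * ennreal a * ennreal b"
      unfolding convolution_layer_cake using a
      by (subst nn_integral_add) (auto simp: nn_integral_cmult)
    also have "ennreal d * ennreal a * ennreal b = ennreal (a * b * d)"
      using a that by (simp add: ennreal_mult'[symmetric] mult_ac)
    finally show ?thesis using lower by (rule order_trans[rotated])
  qed
  then show ?thesis
    using esssup_ge_right_limit[of "a * exp (- a * L)" "a * b" "convolution f g" z0] a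
    by (simp add: a_def b_def L_def)
qed

end

lemma convolution_esssup_ge:
  assumes "log_concave_density f" "log_concave_density g"
  shows "ennreal (exponential_sum_peak (log_concave_density.peak f) (log_concave_density.peak g))
    \<le> esssup lborel (convolution f g)"
proof (cases "log_concave_density.peak f \<le> log_concave_density.peak g")
  case True
  then show ?thesis
    using convolution_esssup_ge_ordered[OF assms] by (simp add: exponential_sum_peak_def)
next
  case False
  then show ?thesis
    using convolution_esssup_ge_ordered[OF assms(2,1)]
      convolution_commute[OF assms[THEN log_concave_density.measurable_f]]
    by (simp add: exponential_sum_peak_def)
qed

section \<open>Exponential variables and the entropy comparison\<close>

text \<open>The convolution is computed explicitly. Its maximum is then bounded by inequalities for
  \<open>exp\<close> centred at the mode, without studying the sign of a derivative.\<close>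

lemma exponential_convolution_le_ordered:
  assumes ab: "0 < a" "a \<le> b"
  shows "convolution (exponential_density a) (exponential_density b) x
    \<le> ennreal (a * exp (- a * optimal_shift a b))"
proof (cases "0 \<le> x")
  case False
  then have "exponential_density a (x - y) * exponential_density b y = 0" for y
    by (simp add: exponential_density_def)
  then have "convolution (exponential_density a) (exponential_density b) x = (\<integral>\<^sup>+y. 0 \<partial>(lborel :: real measure))"
    unfolding convolution_def using ab
    by (intro nn_integral_cong) (auto simp: ennreal_mult'[symmetric] exponential_density_def)
  then show ?thesis by simp
next
  case True
  define L where "L = optimal_shift a b"
  have L: "exp ((b - a) * L) = b / a" using optimal_shift[OF ab] by (simp add: L_def)
  let ?h = "\<lambda>y. a * b * exp (- a * x) * exp (- (b - a) * y)"
  have "\<exists>J. (?h has_integral J) {0..x} \<and> J \<le> a * exp (- a * L)"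
  proof (cases "a = b")
    case eq: True
    have "a * x * exp (- a * x) \<le> exp (-1)"
    proof -
      have "a * x \<le> exp (a * x - 1)" using exp_ge_add_one_self[of "a * x - 1"] by simp
      then have "a * x * exp (- a * x) \<le> exp (a * x - 1) * exp (- a * x)"
        by (intro mult_right_mono) auto
      then show ?thesis by (simp add: exp_add[symmetric])
    qed
    then have "a * (a * x * exp (- a * x)) \<le> a * exp (-1)"
      using ab by (intro mult_left_mono) auto
    moreover have "(?h has_integral a * (a * x * exp (- a * x))) {0..x}"
      using has_integral_const_real[of "a * b * exp (- a * x)" 0 x] True eq by (simp add: mult_ac)
    moreover have "a * L = 1" using eq ab by (simp add: L_def optimal_shift_def)
    ultimately show ?thesis by auto
  next
    case False
    then have "a < b" using ab by simp
    define J where "J = a * b / (b - a) * (exp (- a * x) - exp (- b * x))"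
    have cancel: "- (k / (b - a)) * (e * - (b - a)) = k * e" for k e :: real
      using \<open>a < b\<close> by (simp add: field_simps)
    have "(?h has_integral
        (- (a * b * exp (- a * x) / (b - a)) * exp (- (b - a) * x)
          - - (a * b * exp (- a * x) / (b - a)) * exp (- (b - a) * 0))) {0..x}"
    proof (rule fundamental_theorem_of_calculus[OF True])
      fix y
      have "((\<lambda>y. - (a * b * exp (- a * x) / (b - a)) * exp (- (b - a) * y)) has_real_derivative
          - (a * b * exp (- a * x) / (b - a)) * (exp (- (b - a) * y) * - (b - a))) (at y)"
        using \<open>a < b\<close> by (auto intro!: derivative_eq_intros)
      also have "- (a * b * exp (- a * x) / (b - a)) * (exp (- (b - a) * y) * - (b - a)) = ?h y"
        by (rule cancel)
      finally show "((\<lambda>y. - (a * b * exp (- a * x) / (b - a)) * exp (- (b - a) * y)) has_vector_derivative ?h y)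
          (at y within {0..x})"
        by (simp add: has_real_derivative_iff_has_vector_derivative has_vector_derivative_at_within)
    qed
    also have "- (a * b * exp (- a * x) / (b - a)) * exp (- (b - a) * x)
          - - (a * b * exp (- a * x) / (b - a)) * exp (- (b - a) * 0) = J"
    proof -
      have "exp (- b * x) = exp (- a * x) * exp (- (b - a) * x)"
        by (simp add: exp_add[symmetric] algebra_simps)
      then show ?thesis by (simp add: J_def algebra_simps)
    qed
    finally have "(?h has_integral J) {0..x}" .
    moreover have "J \<le> a * exp (- a * L)"
    proof -
      \<comment> \<open>Relative to the mode, the first-order condition extracts the common factor
        \<open>exp (- a * L)\<close>. What remains is convexity of \<open>exp\<close> between 0 and
        \<open>- b * w\<close>, with weight \<open>a / b\<close> on the latter.\<close>
      define w where "w = x - L"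
      have "exp ((1 - a / b) *\<^sub>R 0 + (a / b) *\<^sub>R (- b * w)) \<le> (1 - a / b) * exp 0 + a / b * exp (- b * w)"
        using ab by (intro convex_onD[OF exp_convex]) auto
      then have conv: "exp (- a * w) \<le> (1 - a / b) + a / b * exp (- b * w)"
        using ab by simp
      have "exp (b * L) = exp ((b - a) * L) * exp (a * L)"
        by (simp add: exp_add[symmetric] algebra_simps)
      then have eL: "exp (- b * L) = a / b * exp (- a * L)"
        using L ab by (simp add: exp_minus inverse_eq_divide)
      have "exp (- b * x) = exp (- b * L) * exp (- b * w)"
        by (simp add: w_def exp_add[symmetric] algebra_simps)
      then have eb: "exp (- b * x) = a / b * exp (- a * L) * exp (- b * w)"
        by (simp only: eL)
      have ea: "exp (- a * x) = exp (- a * L) * exp (- a * w)"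
        by (simp add: w_def exp_add[symmetric] algebra_simps)
      have "J = a * b / (b - a) * exp (- a * L) * (exp (- a * w) - a / b * exp (- b * w))"
        unfolding J_def ea eb by (simp only: right_diff_distrib mult_ac)
      also have "\<dots> \<le> a * b / (b - a) * exp (- a * L) * (1 - a / b)"
        using conv ab \<open>a < b\<close> by (intro mult_left_mono) auto
      also have "\<dots> = a * exp (- a * L) * (b * (1 - a / b) / (b - a))" by simp
      also have "b * (1 - a / b) / (b - a) = 1" using ab \<open>a < b\<close> by (simp add: right_diff_distrib)
      finally show ?thesis by simp
    qed
    ultimately show ?thesis by blast
  qed
  then obtain J where J: "(?h has_integral J) {0..x}" "J \<le> a * exp (- a * L)" by blast
  have "convolution (exponential_density a) (exponential_density b) x
      = (\<integral>\<^sup>+y. ennreal (?h y) * indicator {0..x} y \<partial>lborel)"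
    unfolding convolution_def
  proof (rule nn_integral_cong)
    fix y :: real
    show "ennreal (exponential_density a (x - y)) * ennreal (exponential_density b y)
        = ennreal (?h y) * indicator {0..x} y"
    proof (cases "y \<in> {0..x}")
      case True
      then have "ennreal (exponential_density a (x - y)) * ennreal (exponential_density b y)
          = ennreal (a * exp (- (x - y) * a) * (b * exp (- y * b)))"
        using ab by (simp add: exponential_density_def ennreal_mult')
      also have "a * exp (- (x - y) * a) * (b * exp (- y * b)) = a * b * exp (- (x - y) * a + - y * b)"
        by (simp only: exp_add mult_ac)
      also have "\<dots> = ?h y" by (simp add: exp_add[symmetric] mult.assoc algebra_simps)
      finally show ?thesis using True by simp
    qed (auto simp: exponential_density_def)
  qed
  also have "\<dots> = ennreal J"
    by (rule nn_integral_has_integral_lebesgue'[OF _ J(1)]) (use ab in auto)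
  also have "\<dots> \<le> ennreal (a * exp (- a * L))" by (rule ennreal_leI[OF J(2)])
  finally show ?thesis by (simp add: L_def)
qed

lemma exponential_convolution_esssup_le:
  assumes ab: "0 < a" "0 < b"
  shows "esssup lborel (convolution (exponential_density a) (exponential_density b))
    \<le> ennreal (exponential_sum_peak a b)"
proof -
  have le: "convolution (exponential_density a) (exponential_density b) x
      \<le> ennreal (exponential_sum_peak a b)" for x
  proof (cases "a \<le> b")
    case True
    then show ?thesis
      using exponential_convolution_le_ordered[of a b x] ab by (simp add: exponential_sum_peak_def)
  next
    case False
    then show ?thesis
      using exponential_convolution_le_ordered[of b a x] ab
        convolution_commute[of "exponential_density b" "exponential_density a"]
      by (simp add: exponential_sum_peak_def)
  qed
  have "convolution (exponential_density a) (exponential_density b) \<in> borel_measurable lborel"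
    unfolding convolution_def by measurable
  then show ?thesis using le by (intro esssup_I) auto
qed

lemma esssup_exponential_density:
  assumes "0 < l"
  shows "esssup lborel (\<lambda>x. ennreal (exponential_density l x)) = ennreal l"
proof (rule antisym)
  show "esssup lborel (\<lambda>x. ennreal (exponential_density l x)) \<le> ennreal l"
    using assms by (intro esssup_I) (auto simp: exponential_density_def intro!: ennreal_leI)
  show "ennreal l \<le> esssup lborel (\<lambda>x. ennreal (exponential_density l x))"
  \<comment> \<open>The slope of the density just right of 0 is \<open>- l * l\<close>, and by
    \<open>exp z \<ge> 1 + z\<close> the density stays above its tangent there.\<close>
  proof (rule esssup_ge_right_limit[where z = 0 and C = "l * l"])
    fix d :: real assume "0 < d"
    have "l * (1 - d * l) \<le> l * exp (- d * l)"
      using assms exp_ge_add_one_self[of "- d * l"] by (intro mult_left_mono) auto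
    then have "l \<le> l * exp (- d * l) + l * l * d" by (simp add: algebra_simps)
    then have "ennreal l \<le> ennreal (l * exp (- d * l)) + ennreal (l * l * d)"
      using assms \<open>0 < d\<close> by (simp add: ennreal_leI flip: ennreal_plus)
    then show "ennreal l \<le> ennreal (exponential_density l (0 + d)) + ennreal (l * l * d)"
      using \<open>0 < d\<close> by (simp add: exponential_density_def)
  qed (use assms in auto)
qed

section \<open>Transfer from densities to random variables\<close>

lemma ln_ext_ennreal: "0 < x \<Longrightarrow> ln_ext (ennreal x) = ereal (ln x)"
  by (simp add: ln_ext_def ennreal_eq_0_iff)

lemma ln_ext_mono: "s \<le> t \<Longrightarrow> ln_ext s \<le> ln_ext t"
  by (cases s; cases t) (auto simp: ln_ext_def ennreal_eq_0_iff ennreal_le_iff top_unique)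

lemma log_concave_rv_density:
  assumes "prob_space M" "log_concave_rv M X"
  obtains f where "log_concave_density f" "distributed M lborel X (\<lambda>x. ennreal (f x))"
    "h_inf M X = - ereal (ln (log_concave_density.peak f))"
proof -
  obtain f where f: "log_concave_fun f" "distributed M lborel X (\<lambda>x. ennreal (f x))"
    using assms by (auto simp: log_concave_rv_def)
  have meas: "(\<lambda>x. ennreal (f x)) \<in> borel_measurable borel"
    using distributed_borel_measurable[OF f(2)] by simp
  \<comment> \<open>\<open>distributed\<close> gives measurability only after the embedding into
    \<open>ennreal\<close>; nonnegativity recovers \<open>f\<close> itself.\<close>
  have "(\<lambda>x. enn2real (ennreal (f x))) \<in> borel_measurable borel"
    using meas by measurable
  then have [measurable]: "f \<in> borel_measurable borel"
    by (simp add: log_concave_fun_nonneg[OF f(1)])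
  interpret prob_space M by fact
  have "(\<integral>\<^sup>+x. ennreal (f x) \<partial>lborel) = emeasure (density lborel (\<lambda>x. ennreal (f x))) UNIV"
    by (simp add: emeasure_density)
  also have "\<dots> = emeasure (distr M lborel X) UNIV"
    using distributed_distr_eq_density[OF f(2)] by simp
  also have "\<dots> = 1"
    using distributed_measurable[OF f(2)] by (simp add: emeasure_distr emeasure_space_1)
  finally have dens: "log_concave_density f"
    using f(1) by unfold_locales auto
  then interpret log_concave_density f .
  show thesis
    using that[OF dens f(2)] h_inf_distributed[OF f(2)] esssup_eq_peak ln_ext_ennreal[OF peak_pos]
    by simp
qed

lemma h_inf_sum_eq:
  assumes "prob_space M" "prob_space.indep_var M borel X borel Y"
    and "distributed M lborel X (\<lambda>x. ennreal (f x))" "distributed M lborel Y (\<lambda>x. ennreal (g x))"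
  shows "h_inf M (\<lambda>\<omega>. X \<omega> + Y \<omega>) = - ln_ext (esssup lborel (convolution f g))"
  unfolding convolution_def
  by (rule h_inf_distributed[OF prob_space.distributed_convolution[OF assms]])

theorem theorem3p4:
  fixes M :: "'a measure" and X Y :: "'a \<Rightarrow> real"
  assumes "prob_space M"
    and "prob_space.indep_var M borel X borel Y"
    and "log_concave_rv M X" and "log_concave_rv M Y"
  shows "(\<forall>(N :: 'b measure) Z W.
            prob_space N \<and> prob_space.indep_var N borel Z borel W \<and>
            exponential_rv N Z \<and> exponential_rv N W \<and>
            h_inf N Z = h_inf M X \<and> h_inf N W = h_inf M Y \<longrightarrow>
            h_inf M (\<lambda>\<omega>. X \<omega> + Y \<omega>) \<le> h_inf N (\<lambda>\<omega>. Z \<omega> + W \<omega>))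
       \<and> (distr M borel X = distr M borel Y \<longrightarrow>
            h_inf M (\<lambda>\<omega>. X \<omega> + Y \<omega>) \<le> h_inf M X + 1)"
proof -
  obtain f where f: "log_concave_density f" "distributed M lborel X (\<lambda>x. ennreal (f x))"
    "h_inf M X = - ereal (ln (log_concave_density.peak f))"
    using log_concave_rv_density[OF assms(1,3)] .
  obtain g where g: "log_concave_density g" "distributed M lborel Y (\<lambda>x. ennreal (g x))"
    "h_inf M Y = - ereal (ln (log_concave_density.peak g))"
    using log_concave_rv_density[OF assms(1,4)] .
  define a b where "a = log_concave_density.peak f" and "b = log_concave_density.peak g"
  have ab: "0 < a" "0 < b"
    using f(1) g(1) by (auto simp: a_def b_def log_concave_density.peak_pos)
  \<comment> \<open>Both conclusions follow from this bound, which involves only the peaks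
    \<open>a\<close> and \<open>b\<close>.\<close>
  have XY: "h_inf M (\<lambda>\<omega>. X \<omega> + Y \<omega>) \<le> - ln_ext (ennreal (exponential_sum_peak a b))"
    unfolding h_inf_sum_eq[OF assms(1,2) f(2) g(2)] ereal_minus_le_minus a_def b_def
    by (rule ln_ext_mono[OF convolution_esssup_ge[OF f(1) g(1)]])
  have "h_inf M (\<lambda>\<omega>. X \<omega> + Y \<omega>) \<le> h_inf N (\<lambda>\<omega>. Z \<omega> + W \<omega>)"
    if N: "prob_space N" "prob_space.indep_var N borel Z borel W"
      and Z: "exponential_rv N Z" "h_inf N Z = h_inf M X"
      and W: "exponential_rv N W" "h_inf N W = h_inf M Y"
    for N :: "'b measure" and Z W
  proof -
    obtain l where l: "0 < l" "distributed N lborel Z (\<lambda>x. ennreal (exponential_density l x))"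
      using Z by (auto simp: exponential_rv_def)
    obtain m where m: "0 < m" "distributed N lborel W (\<lambda>x. ennreal (exponential_density m x))"
      using W by (auto simp: exponential_rv_def)
    \<comment> \<open>An exponential density has its rate as essential supremum, so equal entropies
      force the rates to be the peaks of \<open>f\<close> and \<open>g\<close>.\<close>
    have "ln l = ln a"
      using h_inf_distributed[OF l(2)] Z(2) f(3) l(1)
      by (simp add: esssup_exponential_density ln_ext_ennreal a_def)
    moreover have "ln m = ln b"
      using h_inf_distributed[OF m(2)] W(2) g(3) m(1)
      by (simp add: esssup_exponential_density ln_ext_ennreal b_def)
    ultimately have "l = a" "m = b" using l(1) m(1) ab by auto
    then have "- ln_ext (ennreal (exponential_sum_peak a b)) \<le> h_inf N (\<lambda>\<omega>. Z \<omega> + W \<omega>)"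
      unfolding h_inf_sum_eq[OF N l(2) m(2)] ereal_minus_le_minus
      by (intro ln_ext_mono) (simp add: exponential_convolution_esssup_le ab)
    with XY show ?thesis by (rule order_trans)
  qed
  moreover have "h_inf M (\<lambda>\<omega>. X \<omega> + Y \<omega>) \<le> h_inf M X + 1" if "distr M borel X = distr M borel Y"
  proof -
    have "distr M lborel X = distr M borel X" "distr M lborel Y = distr M borel Y"
      by (auto intro: distr_cong)
    then have "h_inf M X = h_inf M Y" using that by (simp add: h_inf_def)
    then have "a = b" using f(3) g(3) ab by (simp add: a_def b_def)
    \<comment> \<open>For equal peaks the mode is \<open>1 / a\<close>, so the factor
      \<open>exp (-1)\<close> produces the additive constant 1.\<close>
    then have "exponential_sum_peak a b = a * exp (-1)"
      using ab by (simp add: exponential_sum_peak_def optimal_shift_def)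
    then have "- ln_ext (ennreal (exponential_sum_peak a b)) = h_inf M X + 1"
      using ab f(3) by (simp add: ln_ext_ennreal ln_mult a_def one_ereal_def)
    then show ?thesis using XY by simp
  qed
  ultimately show ?thesis by blast
qed

end
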